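(* Let $G$ be a graph and $\mathcal{P}=\{V_1,\dots,V_t\}$ a partition of $V(G)$ into sets each inducing a clique, such that $G_{\mathcal{P}}$ has maximum degree $\Delta$. Let $U_i\subseteq V_i$ be constructed as described in the context, let $H=G[\bigcup_i U_i]$ and $\mathcal{P}'=\{U_i: V_i\in\mathcal{P}\}$. Then $G$ has a canonical cycle cover (with respect to $\mathcal{P}$) of size $k$ if and only if $H$ has a canonical cycle cover (with respect to $\mathcal{P}'$) of size $k$.
   Context: $G_{\mathcal{P}}$ is obtained from $G$ by contracting each $V_i$ to a vertex (removing loops and parallel edges); $N(V_i)$ denotes the neighbours of $V_i$ in $G_{\mathcal{P}}$. $E(U,W)$ is the set of edges between disjoint sets $U,W$. A cycle cover of a graph is a set of vertex-disjoint cycles whose vertex sets cover all vertices; its size is the number of cycles. For a partition $\mathcal{Q}$ of the vertex set into cliques, a set $\mathcal{C}$ of vertex-disjoint cycles is canonical if (1) for every part $W$ at most one $C\in\mathcal{C}$ has $V(C)\subseteq W$, and (2) for every two distinct parts $W,W'$ at most one $C\in\mathcal{C}$ has $E(C)\cap E(W,W')\neq\emptyset$, and for it $|E(C)\cap E(W,W')|\le 2$. Construction of $U_i$: for $V_i\in\mathcal{P}$ and $V_j\in N(V_i)$, let $V_i(j)=\{v\in V_i:N(v)\cap V_j\ne\emptyset\}$; let $H_{ij}$ be the bipartite graph on $V_i(j)\cup V_j(i)$ with edge set $E(V_i,V_j)$, $M_{ij}$ a maximal matching of $H_{ij}$, $M'_{ij}\subseteq M_{ij}$ an arbitrary subset of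 size $\min\{6\Delta,|M_{ij}|\}$, and $L_i(j)$ (resp. $L_j(i)$) the endpoints of $M'_{ij}$ in $V_i$ (resp. $V_j$). If $|M_{ij}|\ge 6\Delta$, set $U_i(j)=L_i(j)$, $U_j(i)=L_j(i)$. Otherwise set $U_i(j)=L_i(j)$, $U_j(i)=L_j(i)$, then for each $u\in L_i(j)$ add $\min\{|N(u)\cap V_j|,6\Delta-1\}$ neighbours of $u$ in $V_j$ to $U_j(i)$, and for each $v\in L_j(i)$ add $\min\{|N(v)\cap V_i|,6\Delta-1\}$ neighbours of $v$ in $V_i$ to $U_i(j)$. Let $U_i=\bigcup_{V_j\in N(V_i)}U_i(j)$, and finally add $\min\{4\Delta+3,|V_i\setminus U_i|\}$ arbitrary vertices of $V_i\setminus U_i$ to $U_i$. *)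

theory Defs
  imports Main "HOL-Library.Disjoint_Sets"
begin

type_synonym 'a graph = "'a set \<times> 'a set set"

abbreviation verts :: "'a graph \<Rightarrow> 'a set" where "verts \<equiv> fst"
abbreviation edges :: "'a graph \<Rightarrow> 'a set set" where "edges \<equiv> snd"

definition simple_graph :: "'a graph \<Rightarrow> bool" where
  "simple_graph G \<longleftrightarrow>
     finite (verts G) \<and> (\<forall>e\<in>edges G. e \<subseteq> verts G \<and> card e = 2)"

definition subgraph :: "'a graph \<Rightarrow> 'a graph \<Rightarrow> bool" where
  "subgraph H G \<longleftrightarrow> verts H \<subseteq> verts G \<and> edges H \<subseteq> edges G"

definition induced :: "'a graph \<Rightarrow> 'a set \<Rightarrow> 'a graph" where
  "induced G S = (verts G \<inter> S, {e \<in> edges G. e \<subseteq> S})"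

definition nbrs :: "'a graph \<Rightarrow> 'a \<Rightarrow> 'a set" where
  "nbrs G v = {w. {v, w} \<in> edges G}"

text \<open>The maximum degree of the graph without vertices is 0.\<close>

definition max_degree :: "'a graph \<Rightarrow> nat" where
  "max_degree G = Max (insert 0 ((\<lambda>v. card (nbrs G v)) ` verts G))"

definition clique :: "'a graph \<Rightarrow> 'a set \<Rightarrow> bool" where
  "clique G W \<longleftrightarrow>
     W \<subseteq> verts G \<and> (\<forall>u\<in>W. \<forall>v\<in>W. u \<noteq> v \<longrightarrow> {u, v} \<in> edges G)"

definition edges_between :: "'a graph \<Rightarrow> 'a set \<Rightarrow> 'a set \<Rightarrow> 'a set set" where
  "edges_between G U W = {e \<in> edges G. \<exists>u\<in>U. \<exists>w\<in>W. e = {u, w}}"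

definition clique_partition :: "'a graph \<Rightarrow> 'a set set \<Rightarrow> bool" where
  "clique_partition G P \<longleftrightarrow> partition_on (verts G) P \<and> (\<forall>W\<in>P. clique G W)"

text \<open>The vertices of the contracted graph are the parts themselves.\<close>

definition contract :: "'a graph \<Rightarrow> 'a set set \<Rightarrow> 'a set graph" where
  "contract G P =
     (P, {{W, W'} |W W'. W \<in> P \<and> W' \<in> P \<and> W \<noteq> W' \<and> edges_between G W W' \<noteq> {}})"

definition matching :: "'a graph \<Rightarrow> 'a set set \<Rightarrow> bool" where
  "matching G M \<longleftrightarrow> M \<subseteq> edges G \<and> disjoint M"

definition maximal_matching :: "'a graph \<Rightarrow> 'a set set \<Rightarrow> bool" where
  "maximal_matching G M \<longleftrightarrow>
     matching G M \<and> (\<forall>N. matching G N \<and> M \<subseteq> N \<longrightarrow> N = M)"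

text \<open>
  Cycles are subgraphs rather than closed walks, so that rotations and reversals of the same
  cycle are not distinguished.
\<close>

definition is_cycle :: "'a graph \<Rightarrow> bool" where
  "is_cycle C \<longleftrightarrow>
     (\<exists>vs. distinct vs \<and> 3 \<le> length vs \<and> verts C = set vs \<and>
           edges C = {{vs ! i, vs ! (Suc i mod length vs)} |i. i < length vs})"

definition disjoint_cycles :: "'a graph \<Rightarrow> 'a graph set \<Rightarrow> bool" where
  "disjoint_cycles G \<C> \<longleftrightarrow>
     (\<forall>C\<in>\<C>. is_cycle C \<and> subgraph C G) \<and>
     pairwise (\<lambda>C D. disjnt (verts C) (verts D)) \<C>"

definition cycle_cover :: "'a graph \<Rightarrow> 'a graph set \<Rightarrow> bool" where
  "cycle_cover G \<C> \<longleftrightarrow> disjoint_cycles G \<C> \<and> \<Union> (verts ` \<C>) = verts G"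

definition canonical :: "'a graph \<Rightarrow> 'a set set \<Rightarrow> 'a graph set \<Rightarrow> bool" where
  "canonical G Q \<C> \<longleftrightarrow>
     (\<forall>W\<in>Q. \<exists>\<^sub>\<le>\<^sub>1 C. C \<in> \<C> \<and> verts C \<subseteq> W) \<and>
     (\<forall>W\<in>Q. \<forall>W'\<in>Q. W \<noteq> W' \<longrightarrow>
        (\<exists>\<^sub>\<le>\<^sub>1 C. C \<in> \<C> \<and> edges C \<inter> edges_between G W W' \<noteq> {}) \<and>
        (\<forall>C\<in>\<C>. card (edges C \<inter> edges_between G W W') \<le> 2))"

definition has_canonical_cycle_cover :: "'a graph \<Rightarrow> 'a set set \<Rightarrow> nat \<Rightarrow> bool" where
  "has_canonical_cycle_cover G Q k \<longleftrightarrow>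
     (\<exists>\<C>. cycle_cover G \<C> \<and> canonical G Q \<C> \<and> card \<C> = k)"

text \<open>
  The construction of the sets \<open>U\<^sub>i\<close>. A part \<open>V\<^sub>i\<close> serves as its own index, so below \<open>W\<close> and
  \<open>W'\<close> play the roles of \<open>V\<^sub>i\<close> and \<open>V\<^sub>j\<close>: \<open>boundary G W W'\<close> is \<open>V\<^sub>i(j)\<close>, \<open>between_graph G W W'\<close>
  is \<open>H\<^sub>i\<^sub>j\<close>, \<open>matched M' W W'\<close> is \<open>L\<^sub>i(j)\<close> and \<open>link \<Delta> M M' S W W'\<close> is \<open>U\<^sub>i(j)\<close>.
\<close>

definition boundary :: "'a graph \<Rightarrow> 'a set \<Rightarrow> 'a set \<Rightarrow> 'a set" where
  "boundary G W W' = {v \<in> W. nbrs G v \<inter> W' \<noteq> {}}"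

definition between_graph :: "'a graph \<Rightarrow> 'a set \<Rightarrow> 'a set \<Rightarrow> 'a graph" where
  "between_graph G W W' = (boundary G W W' \<union> boundary G W' W, edges_between G W W')"

definition matched :: "('a set \<Rightarrow> 'a set \<Rightarrow> 'a set set) \<Rightarrow> 'a set \<Rightarrow> 'a set \<Rightarrow> 'a set" where
  "matched M' W W' = \<Union> (M' W W') \<inter> W"

text \<open>
  \<open>S W W' u\<close> is the set of neighbours in \<open>W'\<close> chosen for a vertex \<open>u\<close> of \<open>matched M' W W'\<close>;
  it is added on the side of \<open>W'\<close>. Hence the sets added on the side of \<open>W\<close> are \<open>S W' W v\<close>.
\<close>

definition link ::
  "nat \<Rightarrow> ('a set \<Rightarrow> 'a set \<Rightarrow> 'a set set) \<Rightarrow> ('a set \<Rightarrow> 'a set \<Rightarrow> 'a set set) \<Rightarrow>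
   ('a set \<Rightarrow> 'a set \<Rightarrow> 'a \<Rightarrow> 'a set) \<Rightarrow> 'a set \<Rightarrow> 'a set \<Rightarrow> 'a set" where
  "link \<Delta> M M' S W W' =
     (if 6 * \<Delta> \<le> card (M W W') then matched M' W W'
      else matched M' W W' \<union> (\<Union>v\<in>matched M' W' W. S W' W v))"

text \<open>
  \<open>reduction G P \<Delta> U\<close>: the family \<open>U\<close>, with \<open>U V\<^sub>i = U\<^sub>i\<close>, arises from some outcome of the
  arbitrary choices. The matchings belong to the unordered pair of parts, whence the symmetry
  conditions. The truncated subtraction in \<open>6 * \<Delta> - 1\<close> is harmless: \<open>\<Delta> > 0\<close> as soon as some
  part has a neighbour.
\<close>

definition reduction ::
  "'a graph \<Rightarrow> 'a set set \<Rightarrow> nat \<Rightarrow> ('a set \<Rightarrow> 'a set) \<Rightarrow> bool" where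
  "reduction G P \<Delta> U \<longleftrightarrow>
     (\<exists>M M' S X.
        (\<forall>W\<in>P. \<forall>W'\<in>nbrs (contract G P) W.
           M W W' = M W' W \<and> M' W W' = M' W' W \<and>
           maximal_matching (between_graph G W W') (M W W') \<and>
           M' W W' \<subseteq> M W W' \<and> card (M' W W') = min (6 * \<Delta>) (card (M W W')) \<and>
           (\<forall>u\<in>matched M' W W'.
              S W W' u \<subseteq> nbrs G u \<inter> W' \<and>
              card (S W W' u) = min (card (nbrs G u \<inter> W')) (6 * \<Delta> - 1))) \<and>
        (\<forall>W\<in>P.
           let U0 = (\<Union>W'\<in>nbrs (contract G P) W. link \<Delta> M M' S W W')
           in X W \<subseteq> W - U0 \<and> card (X W) = min (4 * \<Delta> + 3) (card (W - U0)) \<and>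
              U W = U0 \<union> X W))"

end

theory Submission
  imports Defs
begin

text \<open>
  Fix a canonical cover. At most \<open>2 * \<Delta>\<close> vertices of a part are ends of edges leaving the
  part; every other vertex of the part is interior, that is, both its cycle neighbours lie in the
  same part. As parts are cliques, an interior vertex can be cut out of its cycle or inserted
  into an edge inside its part without changing the crossing edges. Cutting out destroys only a
  triangle inside the part, and there the vertex can be exchanged for another interior one if the
  part has at least four interior vertices. The construction of the sets \<open>U\<^sub>i\<close> leaves room for
  all of this. A crossing edge \<open>uv\<close> that is not kept is replaced by a path \<open>u v' v\<close> or
  \<open>u u' v' v\<close> through unused kept vertices that are first cut out of their cycles. Once all
  crossing edges are kept, the vertices outside the \<open>U\<^sub>i\<close> are interior and are cut out one by
  one. Conversely, they are inserted one by one, as a part that loses vertices always has an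
  interior vertex among the kept ones, hence an edge to insert into.
\<close>

section \<open>Surgery on cycles\<close>

fun path_edges :: "'a list \<Rightarrow> 'a set set" where
  "path_edges (x # y # zs) = insert {x, y} (path_edges (y # zs))"
| "path_edges _ = {}"

lemma path_edges_append:
  "path_edges (xs @ y # ys) = path_edges (xs @ [y]) \<union> path_edges (y # ys)"
  by (induction xs rule: path_edges.induct) auto

lemma path_edges_subset: "e \<in> path_edges xs \<Longrightarrow> e \<subseteq> set xs"
  by (induction xs rule: path_edges.induct) auto

lemma path_edges_nth: "path_edges xs = {{xs ! i, xs ! Suc i} |i. Suc i < length xs}"
proof (induction xs rule: path_edges.induct)
  case (1 x y zs)
  have "{{(x # y # zs) ! i, (x # y # zs) ! Suc i} |i. Suc i < length (x # y # zs)} =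
      insert {x, y} {{(y # zs) ! i, (y # zs) ! Suc i} |i. Suc i < length (y # zs)}" (is "?L = ?R")
  proof (intro subset_antisym subsetI)
    fix e assume "e \<in> ?L"
    then obtain i where "e = {(x # y # zs) ! i, (x # y # zs) ! Suc i}" "Suc i < length (x # y # zs)"
      by blast
    then show "e \<in> ?R" by (cases i) auto
  next
    fix e assume "e \<in> ?R"
    then consider "e = {x, y}"
      | i where "e = {(y # zs) ! i, (y # zs) ! Suc i}" "Suc i < length (y # zs)"
      by blast
    then show "e \<in> ?L"
    proof cases
      case 1
      then have "e = {(x # y # zs) ! 0, (x # y # zs) ! Suc 0} \<and> Suc 0 < length (x # y # zs)"
        by simp
      then show ?thesis by blast
    next
      case 2
      then have "e = {(x # y # zs) ! Suc i, (x # y # zs) ! Suc (Suc i)} \<and>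
          Suc (Suc i) < length (x # y # zs)"
        by simp
      then show ?thesis by blast
    qed
  qed
  with 1 show ?case by simp
qed auto

text \<open>The edge set from \<open>is_cycle_def\<close> as a function of the vertex list, so that
  a cycle can be rotated and cut open at a chosen place.\<close>

definition ring_edges :: "'a list \<Rightarrow> 'a set set" where
  "ring_edges vs = {{vs ! i, vs ! (Suc i mod length vs)} |i. i < length vs}"

lemma is_cycle_iff:
  "is_cycle C \<longleftrightarrow>
    (\<exists>vs. distinct vs \<and> 3 \<le> length vs \<and> verts C = set vs \<and> edges C = ring_edges vs)"
  unfolding is_cycle_def ring_edges_def ..

text \<open>Repeating the first vertex at the end replaces the index arithmetic modulo the length by
  recursion on lists; only the last index wraps around.\<close>

lemma ring_edges_Cons: "ring_edges (x # xs) = path_edges (x # xs @ [x])"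
proof -
  have "(x # xs) ! (Suc i mod length (x # xs)) = (x # xs @ [x]) ! Suc i"
    "(x # xs) ! i = (x # xs @ [x]) ! i" if "i < length (x # xs)" for i
  proof -
    show "(x # xs) ! (Suc i mod length (x # xs)) = (x # xs @ [x]) ! Suc i"
      using that by (cases "Suc i = length (x # xs)") (auto simp: nth_append)
    show "(x # xs) ! i = (x # xs @ [x]) ! i"
      using that by (auto simp: nth_append nth_Cons split: nat.split)
  qed
  then have "{(x # xs) ! i, (x # xs) ! (Suc i mod length (x # xs))} =
      {(x # xs @ [x]) ! i, (x # xs @ [x]) ! Suc i}" if "i < length (x # xs)" for i
    using that by presburger
  then have "(\<lambda>i. {(x # xs) ! i, (x # xs) ! (Suc i mod length (x # xs))}) ` {..<length (x # xs)} =
      (\<lambda>i. {(x # xs @ [x]) ! i, (x # xs @ [x]) ! Suc i}) ` {..<length (x # xs)}"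
    by (intro image_cong) auto
  then show ?thesis
    unfolding ring_edges_def path_edges_nth setcompr_eq_image by (simp add: lessThan_def)
qed

lemma ring_edges_rotate: "ring_edges (rotate n vs) = ring_edges vs"
proof (induction n)
  case (Suc n)
  have "ring_edges (rotate1 us) = ring_edges us" for us :: "'a list"
  proof (cases us)
    case (Cons x xs)
    show ?thesis
    proof (cases xs)
      case (Cons y ys)
      with \<open>us = x # xs\<close> show ?thesis
        \<comment> \<open>Split at \<open>x\<close>, the rotated closed path consists of the path
          from \<open>y\<close> to \<open>x\<close> and the edge \<open>{x, y}\<close>, just as the
          original one does.\<close>
        using path_edges_append[of "y # ys" x "[y]"] by (auto simp: ring_edges_Cons)
    qed (simp add: Cons)
  qed simp
  with Suc show ?case by simp
qed simp

lemma cycle_list_from_vertex: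
  assumes "is_cycle C" "v \<in> verts C"
  obtains vs where "distinct (v # vs)" "2 \<le> length vs" "verts C = set (v # vs)"
    "edges C = path_edges (v # vs @ [v])"
proof -
  obtain us where us: "distinct us" "3 \<le> length us" "verts C = set us" "edges C = ring_edges us"
    using assms(1) unfolding is_cycle_iff by blast
  then obtain ys zs where "us = ys @ v # zs" using assms(2) by (metis split_list)
  then have "rotate (length ys) us = v # zs @ ys" by (simp add: rotate_append)
  then have "ring_edges us = ring_edges (v # zs @ ys)" by (metis ring_edges_rotate)
  with us \<open>us = ys @ v # zs\<close> show ?thesis
    by (intro that[of "zs @ ys"]) (auto simp: ring_edges_Cons)
qed

lemma is_cycle_listI:
  "distinct (v # vs) \<Longrightarrow> 2 \<le> length vs \<Longrightarrow> is_cycle (set (v # vs), path_edges (v # vs @ [v]))"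
  unfolding is_cycle_iff by (intro exI[of _ "v # vs"]) (auto simp: ring_edges_Cons)

lemma cycle_finite:
  assumes "is_cycle C"
  shows "finite (verts C)" "finite (edges C)" "3 \<le> card (verts C)"
    and "e \<in> edges C \<Longrightarrow> e \<subseteq> verts C"
proof -
  obtain us where us: "distinct us" "3 \<le> length us" "verts C = set us" "edges C = ring_edges us"
    using assms(1) unfolding is_cycle_iff by blast
  then show fin: "finite (verts C)" "3 \<le> card (verts C)" by (auto simp: distinct_card)
  from us have sub: "e \<subseteq> verts C" if "e \<in> edges C" for e
    using that path_edges_subset[of e] by (cases us) (force simp: ring_edges_Cons)+
  show "e \<in> edges C \<Longrightarrow> e \<subseteq> verts C" by (rule sub)
  show "finite (edges C)" using fin sub by (auto intro: finite_subset[of _ "Pow (verts C)"])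
qed

lemma cycle_nonempty: "is_cycle C \<Longrightarrow> verts C \<noteq> {}"
  using cycle_finite(3)[of C] by auto

text \<open>Listed from \<open>w\<close>, the cycle reads \<open>w, b, rs, a\<close>, and
  \<open>R\<close> is the path from \<open>b\<close> to \<open>a\<close>. With four vertices
  \<open>rs\<close> is nonempty, so closing \<open>R\<close> by \<open>{a, b}\<close> still gives at
  least a triangle.\<close>

lemma cycle_suppress_vertex:
  assumes "is_cycle C" "w \<in> verts C"
  obtains a b R where "a \<noteq> b" "a \<noteq> w" "b \<noteq> w" "a \<in> verts C" "b \<in> verts C"
    "edges C = {{a, w}, {w, b}} \<union> R" "\<And>e. e \<in> R \<Longrightarrow> w \<notin> e"
    "4 \<le> card (verts C) \<Longrightarrow> is_cycle (verts C - {w}, insert {a, b} R)"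
    "card (verts C) = 3 \<Longrightarrow> verts C = {w, a, b}"
proof -
  obtain vs where vs: "distinct (w # vs)" "2 \<le> length vs" "verts C = set (w # vs)"
    "edges C = path_edges (w # vs @ [w])"
    using cycle_list_from_vertex[OF assms] .
  obtain b us where "vs = b # us" using vs(2) by (cases vs) auto
  moreover obtain rs a where "us = rs @ [a]"
    using vs(2) \<open>vs = b # us\<close> by (cases us rule: rev_cases) auto
  ultimately have [simp]: "vs = b # rs @ [a]" by simp
  have e: "edges C = {{a, w}, {w, b}} \<union> path_edges (b # rs @ [a])"
    using path_edges_append[of "w # b # rs" a "[w]"] by (auto simp: vs(4))
  have "is_cycle (verts C - {w}, insert {a, b} (path_edges (b # rs @ [a])))"
    if "4 \<le> card (verts C)"
  proof -
    have "rs \<noteq> []" using that vs(1,3) by (auto simp: card_insert_if)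
    then have "is_cycle (set (a # b # rs), path_edges (a # (b # rs) @ [a]))"
      using vs(1) by (intro is_cycle_listI) (auto simp: Suc_le_eq)
    moreover have "set (a # b # rs) = verts C - {w}" using vs(1,3) by auto
    ultimately show ?thesis by simp
  qed
  moreover have "verts C = {w, a, b}" if "card (verts C) = 3"
  proof -
    have "length (w # vs) = 3" using that vs(1,3) distinct_card[OF vs(1)] by simp
    then have "rs = []" by simp
    then show ?thesis using vs(3) by auto
  qed
  moreover have "w \<notin> e" if "e \<in> path_edges (b # rs @ [a])" for e
    using path_edges_subset[OF that] vs(1) by auto
  ultimately show ?thesis
    using vs(1,3) e by (intro that[of a b "path_edges (b # rs @ [a])"]) auto
qed

text \<open>After a rotation the edge joins the first two vertices of the list, and \<open>w\<close>
  is inserted between them. No ambient graph occurs, so this also applies to cycles with edges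
  outside \<open>G\<close>.\<close>

lemma cycle_subdivide_edge:
  assumes "is_cycle C" "{a, b} \<in> edges C" "w \<notin> verts C"
  shows "is_cycle (insert w (verts C), {{a, w}, {w, b}} \<union> (edges C - {{a, b}}))"
proof -
  obtain us where us: "distinct us" "3 \<le> length us" "verts C = set us" "edges C = ring_edges us"
    using assms(1) unfolding is_cycle_iff by blast
  obtain i where i: "{a, b} = {us ! i, us ! (Suc i mod length us)}" "i < length us"
    using assms(2) unfolding us(4) ring_edges_def by blast
  obtain x y rs where xy: "rotate i us = x # y # rs"
    using us(2) by (cases "rotate i us" rule: path_edges.cases)
      (auto dest: arg_cong[of _ _ length])
  have "rotate i us ! 0 = us ! i" "rotate i us ! 1 = us ! (Suc i mod length us)"
    using nth_rotate[of 0 us i] nth_rotate[of 1 us i] us(2) i(2) by (simp_all del: length_0_conv length_greater_0_conv)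
  then have "x = us ! i" "y = us ! (Suc i mod length us)" unfolding xy by auto
  with i(1) have ab: "{a, b} = {x, y}" by simp
  have d: "distinct (x # y # rs)" "verts C = set (x # y # rs)" "3 \<le> length (x # y # rs)"
    using us(1-3) xy by (metis distinct_rotate, metis set_rotate, metis length_rotate)
  then obtain ts z where rs: "rs = ts @ [z]" by (cases rs rule: rev_cases) auto
  have E: "edges C = insert {x, y} (path_edges (y # rs @ [x]))"
    using us(4) ring_edges_rotate[of i us] by (simp add: xy ring_edges_Cons)
  \<comment> \<open>A second occurrence would lie on the path from \<open>y\<close> to
    \<open>z\<close>, which misses \<open>x\<close>, or be \<open>{z, x}\<close> with
    \<open>z\<close> distinct from \<open>y\<close>. So set difference removes exactly the first
    edge.\<close>
  have "{x, y} \<notin> path_edges (y # rs @ [x])"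
    using d(1) path_edges_append[of "y # ts" z "[x]"] path_edges_subset[of "{x, y}" "y # ts @ [z]"]
    by (auto simp: rs doubleton_eq_iff)
  then have "edges C - {{a, b}} = path_edges (y # rs @ [x])"
    using E ab by auto
  moreover have "{{a, w}, {w, b}} = {{x, w}, {w, y}}"
    using ab by (auto simp: doubleton_eq_iff insert_commute)
  moreover have "is_cycle (set (x # w # y # rs), path_edges (x # (w # y # rs) @ [x]))"
    using d assms(3) by (intro is_cycle_listI) auto
  moreover have "set (x # w # y # rs) = insert w (verts C)" using d(2) by auto
  ultimately show ?thesis by simp
qed

section \<open>Canonical covers of clique partitions\<close>

text \<open>Choosing a point of \<open>A\<close> in each member is injective by disjointness. This
  turns bounds on vertices into bounds on matching edges and conversely.\<close>

lemma card_le_by_disjoint_traces: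
  assumes "disjoint M" "\<And>e. e \<in> M \<Longrightarrow> e \<inter> A \<noteq> {}" "finite A"
  shows "card M \<le> card A"
proof -
  have "\<forall>e\<in>M. \<exists>x. x \<in> e \<inter> A" using assms(2) by blast
  then obtain f where f: "\<And>e. e \<in> M \<Longrightarrow> f e \<in> e \<inter> A" by metis
  have "inj_on f M"
    using f assms(1) by (intro inj_onI) (metis IntD1 disjointD disjoint_iff)
  moreover have "f ` M \<subseteq> A" using f by blast
  ultimately show ?thesis using assms(3) by (rule card_inj_on_le)
qed

locale clique_partitioned =
  fixes G :: "'a graph" and P :: "'a set set"
  assumes simple: "simple_graph G" and partition: "clique_partition G P"
begin

lemma part_eqI: "W \<in> P \<Longrightarrow> W' \<in> P \<Longrightarrow> v \<in> W \<Longrightarrow> v \<in> W' \<Longrightarrow> W = W'"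
  using partition unfolding clique_partition_def partition_on_def disjoint_def by blast

lemma part_exists: "v \<in> verts G \<Longrightarrow> \<exists>W\<in>P. v \<in> W"
  using partition unfolding clique_partition_def partition_on_def by blast

lemma part_subset: "W \<in> P \<Longrightarrow> W \<subseteq> verts G"
  using partition unfolding clique_partition_def partition_on_def by blast

lemma part_nonempty: "W \<in> P \<Longrightarrow> W \<noteq> {}"
  using partition unfolding clique_partition_def partition_on_def by blast

lemma finite_verts: "finite (verts G)"
  using simple unfolding simple_graph_def by blast

lemma finite_part: "W \<in> P \<Longrightarrow> finite W"
  using part_subset finite_verts finite_subset by blast

lemma finite_parts: "finite P"
  using finite_verts part_subset by (auto intro!: finite_subset[of P "Pow (verts G)"])

lemma edge_subset: "e \<in> edges G \<Longrightarrow> e \<subseteq> verts G"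
  using simple unfolding simple_graph_def by blast

lemma finite_edges: "finite (edges G)"
  using finite_verts edge_subset by (auto intro!: finite_subset[of "edges G" "Pow (verts G)"])

lemma part_edge: "W \<in> P \<Longrightarrow> u \<in> W \<Longrightarrow> v \<in> W \<Longrightarrow> u \<noteq> v \<Longrightarrow> {u, v} \<in> edges G"
  using partition unfolding clique_partition_def clique_def by blast

lemma edge_doubleton: "e \<in> edges G \<Longrightarrow> \<exists>u v. u \<noteq> v \<and> e = {u, v}"
  using simple unfolding simple_graph_def by (meson card_2_iff)

section \<open>Crossing edges\<close>

definition cross :: "'a set set \<Rightarrow> 'a set set" where
  "cross E = {e \<in> E. \<forall>W\<in>P. \<not> e \<subseteq> W}"

definition crossing :: "'a graph set \<Rightarrow> 'a set set" where
  "crossing \<C> = cross (\<Union> (edges ` \<C>))"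

lemma cross_insert_part: "e \<subseteq> W \<Longrightarrow> W \<in> P \<Longrightarrow> cross (insert e E) = cross E"
  unfolding cross_def by blast

lemma cross_edge_ends:
  assumes "e \<in> cross (edges G)"
  obtains W W' u v where "W \<in> P" "W' \<in> P" "W \<noteq> W'" "u \<in> W" "v \<in> W'" "e = {u, v}"
proof -
  have "e \<in> edges G" using assms unfolding cross_def by simp
  then obtain u v where e: "e = {u, v}" "e \<in> edges G" using edge_doubleton by metis
  then obtain W W' where W: "W \<in> P" "W' \<in> P" "u \<in> W" "v \<in> W'"
    using edge_subset part_exists by (metis insert_subset)
  have "\<not> e \<subseteq> W" using assms W(1) unfolding cross_def by blast
  then have "W \<noteq> W'" using e W by blast
  then show ?thesis using that W e(1) by blast
qed

text \<open>Parts are disjoint, so an edge between two of them lies in none. Hence the second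
  canonicity condition depends only on the crossing edges, and surgery that preserves
  \<open>cross\<close> preserves it.\<close>

lemma edges_between_cross:
  assumes "W \<in> P" "W' \<in> P" "W \<noteq> W'"
  shows "E \<inter> edges_between G W W' = cross E \<inter> edges_between G W W'"
  using assms unfolding cross_def edges_between_def by (blast dest: part_eqI)

lemma mem_edges_between_iff:
  assumes "A \<in> P" "B \<in> P" "A \<noteq> B" "W \<in> P" "W' \<in> P" "u \<in> A" "v \<in> B" "{u, v} \<in> edges G"
  shows "{u, v} \<in> edges_between G W W' \<longleftrightarrow> W = A \<and> W' = B \<or> W = B \<and> W' = A"
proof
  assume "{u, v} \<in> edges_between G W W'"
  then obtain x y where "x \<in> W" "y \<in> W'" "{u, v} = {x, y}" unfolding edges_between_def by blast
  then show "W = A \<and> W' = B \<or> W = B \<and> W' = A"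
    using assms part_eqI by (metis doubleton_eq_iff)
next
  assume "W = A \<and> W' = B \<or> W = B \<and> W' = A"
  then show "{u, v} \<in> edges_between G W W'"
    using assms(6-8) unfolding edges_between_def by blast
qed

text \<open>Covers of the induced subgraph on \<open>Y\<close> are measured against the full parts: for cycles inside
  \<open>Y\<close> it makes no difference whether the parts are first intersected with \<open>Y\<close>.\<close>

definition cov :: "'a set \<Rightarrow> 'a graph set \<Rightarrow> bool" where
  "cov Y \<C> \<longleftrightarrow> Y \<subseteq> verts G \<and> cycle_cover (induced G Y) \<C> \<and> canonical G P \<C>"

text \<open>The edges of a cycle lie in its vertex set, so being a subgraph of the induced graph
  reduces to a condition on vertices, which the union condition already contains.\<close>

lemma cov_iff:
  "cov Y \<C> \<longleftrightarrow> Y \<subseteq> verts G \<and> (\<forall>C\<in>\<C>. is_cycle C \<and> edges C \<subseteq> edges G) \<and>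
     (\<forall>C\<in>\<C>. \<forall>D\<in>\<C>. C \<noteq> D \<longrightarrow> verts C \<inter> verts D = {}) \<and>
     \<Union> (verts ` \<C>) = Y \<and> canonical G P \<C>"
proof (cases "Y \<subseteq> verts G")
  case True
  have "(is_cycle C \<and> subgraph C (induced G Y)) \<longleftrightarrow>
      (is_cycle C \<and> edges C \<subseteq> edges G \<and> verts C \<subseteq> Y)" for C
    using True cycle_finite(4)[of C] unfolding subgraph_def induced_def by fastforce
  moreover have "verts (induced G Y) = Y" using True unfolding induced_def by auto
  ultimately have "cycle_cover (induced G Y) \<C> \<longleftrightarrow>
      (\<forall>C\<in>\<C>. is_cycle C \<and> edges C \<subseteq> edges G \<and> verts C \<subseteq> Y) \<and>
      (\<forall>C\<in>\<C>. \<forall>D\<in>\<C>. C \<noteq> D \<longrightarrow> verts C \<inter> verts D = {}) \<and> \<Union> (verts ` \<C>) = Y"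
    unfolding cycle_cover_def disjoint_cycles_def pairwise_def disjnt_def by simp
  moreover have "verts C \<subseteq> Y" if "\<Union> (verts ` \<C>) = Y" "C \<in> \<C>" for C using that by auto
  ultimately show ?thesis unfolding cov_def by meson
qed (simp add: cov_def)

lemma cov_cycle:
  assumes "cov Y \<C>" "C \<in> \<C>"
  shows "is_cycle C" "edges C \<subseteq> edges G" "verts C \<subseteq> Y"
  using assms unfolding cov_iff by blast+

lemma cov_obtain_cycle:
  assumes "cov Y \<C>" "w \<in> Y"
  obtains C where "C \<in> \<C>" "w \<in> verts C"
  using assms unfolding cov_iff by blast

lemma cov_subset: "cov Y \<C> \<Longrightarrow> Y \<subseteq> verts G"
  unfolding cov_def by blast

lemma crossing_subset: "cov Y \<C> \<Longrightarrow> crossing \<C> \<subseteq> cross (edges G)"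
  using cov_cycle(2)[of Y \<C>] unfolding crossing_def cross_def by fastforce

lemma finite_crossing: "cov Y \<C> \<Longrightarrow> finite (crossing \<C>)"
  using crossing_subset finite_edges unfolding cross_def
  by (auto intro!: finite_subset[of "crossing \<C>" "edges G"])

lemma crossing_obtain_cycle:
  assumes "e \<in> crossing \<C>"
  obtains C where "C \<in> \<C>" "e \<in> edges C"
  using assms unfolding crossing_def cross_def by auto

lemma crossing_split: "C \<in> \<C> \<Longrightarrow> crossing \<C> = cross (edges C) \<union> crossing (\<C> - {C})"
  unfolding crossing_def cross_def by blast

lemma crossing_insert: "crossing (insert C \<C>) = cross (edges C) \<union> crossing \<C>"
  unfolding crossing_def cross_def by blast

lemma cov_inner_unique:
  assumes "cov Y \<C>" "W \<in> P" "C \<in> \<C>" "D \<in> \<C>" "verts C \<subseteq> W" "verts D \<subseteq> W"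
  shows "C = D"
proof -
  have "\<exists>\<^sub>\<le>\<^sub>1 C. C \<in> \<C> \<and> verts C \<subseteq> W"
    using assms(1,2) unfolding cov_def canonical_def by blast
  then show ?thesis using assms(3-) unfolding Uniq_def by blast
qed

lemma cov_between_unique:
  assumes "cov Y \<C>" "W \<in> P" "W' \<in> P" "W \<noteq> W'" "C \<in> \<C>" "D \<in> \<C>"
    "edges C \<inter> edges_between G W W' \<noteq> {}" "edges D \<inter> edges_between G W W' \<noteq> {}"
  shows "C = D"
proof -
  have "\<exists>\<^sub>\<le>\<^sub>1 C. C \<in> \<C> \<and> edges C \<inter> edges_between G W W' \<noteq> {}"
    using assms(1-4) unfolding cov_def canonical_def by blast
  then show ?thesis using assms(5-) unfolding Uniq_def by blast
qed

lemma cov_between_card: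
  assumes "cov Y \<C>" "W \<in> P" "W' \<in> P" "W \<noteq> W'" "C \<in> \<C>"
  shows "card (edges C \<inter> edges_between G W W') \<le> 2"
  using assms unfolding cov_def canonical_def by blast

text \<open>All surgery on covers passes through this exchange. \<open>C'\<close> lies inside a
  part, or uses edges between two parts, only where \<open>C\<close> did, so it inherits the place
  of \<open>C\<close> in both uniqueness conditions.\<close>

lemma cov_replace:
  assumes cov: "cov Y \<C>" and C: "C \<in> \<C>" and C': "is_cycle C'" "edges C' \<subseteq> edges G"
    "verts C' \<subseteq> verts G" "verts C' \<inter> (Y - verts C) = {}"
    and between: "\<And>W W'. W \<in> P \<Longrightarrow> W' \<in> P \<Longrightarrow> W \<noteq> W' \<Longrightarrow>
        card (edges C' \<inter> edges_between G W W') \<le> card (edges C \<inter> edges_between G W W')"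
    and inner: "\<And>W. W \<in> P \<Longrightarrow> verts C' \<subseteq> W \<Longrightarrow> verts C \<subseteq> W"
  shows "cov (Y - verts C \<union> verts C') (insert C' (\<C> - {C}))"
    and "card (insert C' (\<C> - {C})) = card \<C>"
proof -
  let ?D = "insert C' (\<C> - {C})"
  have dis: "verts C' \<inter> verts D = {}" "verts C \<inter> verts D = {}" if "D \<in> \<C> - {C}" for D
    using that cov C C'(4) unfolding cov_iff by blast+
  \<comment> \<open>The other cycles miss the nonempty vertex set of \<open>C'\<close>, so
    \<open>C'\<close> is a new member and the count is unchanged.\<close>
  have new: "C' \<notin> \<C> - {C}" using dis(1) cycle_nonempty[OF C'(1)] by blast
  show "card ?D = card \<C>"
    using new C card_Suc_Diff1[of \<C> C] by (cases "finite \<C>") simp_all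
  have ne: "edges C \<inter> edges_between G W W' \<noteq> {}"
    if "edges C' \<inter> edges_between G W W' \<noteq> {}" "W \<in> P" "W' \<in> P" "W \<noteq> W'" for W W'
  proof
    assume "edges C \<inter> edges_between G W W' = {}"
    then show False using between[OF that(2-4)] that(1) cycle_finite(2)[OF C'(1)] by simp
  qed
  have "canonical G P ?D"
    unfolding canonical_def
  proof (intro conjI ballI impI)
    fix W assume W: "W \<in> P"
    show "\<exists>\<^sub>\<le>\<^sub>1 D. D \<in> ?D \<and> verts D \<subseteq> W"
      using cov_inner_unique[OF cov W] C inner[OF W] unfolding Uniq_def by blast
    fix W' assume W': "W' \<in> P" "W \<noteq> W'"
    show "\<exists>\<^sub>\<le>\<^sub>1 D. D \<in> ?D \<and> edges D \<inter> edges_between G W W' \<noteq> {}"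
      using cov_between_unique[OF cov W W'] C ne[OF _ W W'] unfolding Uniq_def by blast
    fix D assume "D \<in> ?D"
    then show "card (edges D \<inter> edges_between G W W') \<le> 2"
      using cov_between_card[OF cov W W'] C between[OF W W'] by (metis DiffD1 insertE le_trans)
  qed
  moreover have "\<Union> (verts ` ?D) = Y - verts C \<union> verts C'"
  proof -
    have "\<Union> (verts ` (\<C> - {C})) = Y - verts C" using cov C dis(2) unfolding cov_iff by blast
    then show ?thesis by auto
  qed
  moreover have "\<forall>D\<in>?D. is_cycle D \<and> edges D \<subseteq> edges G"
    using cov_cycle(1,2)[OF cov] C' by simp
  moreover have "\<forall>D\<in>?D. \<forall>E\<in>?D. D \<noteq> E \<longrightarrow> verts D \<inter> verts E = {}"
    using cov dis(1) unfolding cov_iff by (simp add: Int_commute)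
  moreover have "Y - verts C \<union> verts C' \<subseteq> verts G"
    using cov_subset[OF cov] C'(3) by blast
  ultimately show "cov (Y - verts C \<union> verts C') ?D"
    unfolding cov_iff by simp
qed

section \<open>Removing and inserting interior vertices\<close>

lemma between_card_le_cross_eq:
  assumes "cross E = cross F" "W \<in> P" "W' \<in> P" "W \<noteq> W'"
  shows "card (E \<inter> edges_between G W W') \<le> card (F \<inter> edges_between G W W')"
  using edges_between_cross[OF assms(2-), of E] edges_between_cross[OF assms(2-), of F] assms(1)
  by simp

lemma interior_edge_subset:
  assumes "cov Y \<C>" "C \<in> \<C>" "w \<in> W" "W \<in> P" "w \<notin> \<Union> (crossing \<C>)" "e \<in> edges C" "w \<in> e"
  shows "e \<subseteq> W"
proof -
  have "e \<notin> crossing \<C>" using assms(5,7) by blast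
  then obtain W' where "W' \<in> P" "e \<subseteq> W'"
    using assms(2,6) unfolding crossing_def cross_def by blast
  then show ?thesis using assms(3,4,7) part_eqI by blast
qed

text \<open>Both neighbours of \<open>w\<close> on its cycle lie in the clique \<open>W\<close>, so
  the shortcut between them is an edge inside \<open>W\<close>. The last conclusion keeps the other
  cycles available for a second surgery.\<close>

lemma cov_suppress_vertex:
  assumes cov: "cov Y \<C>" and C: "C \<in> \<C>" "w \<in> verts C" "4 \<le> card (verts C)"
    and W: "W \<in> P" "w \<in> W" and w: "w \<notin> \<Union> (crossing \<C>)"
  obtains \<C>' where "cov (Y - {w}) \<C>'" "card \<C>' = card \<C>" "crossing \<C>' = crossing \<C>"
    "\<C> - {C} \<subseteq> \<C>'"
proof -
  note cyc = cov_cycle[OF cov C(1)]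
  obtain a b R where ab: "a \<noteq> b" "a \<noteq> w" "b \<noteq> w" "a \<in> verts C" "b \<in> verts C"
    and E: "edges C = {{a, w}, {w, b}} \<union> R"
    and C': "is_cycle (verts C - {w}, insert {a, b} R)"
    using cycle_suppress_vertex[OF cyc(1) C(2)] C(3) by metis
  have inW: "a \<in> W" "b \<in> W"
    using interior_edge_subset[OF cov C(1) W(2,1) w, of "{a, w}"]
      interior_edge_subset[OF cov C(1) W(2,1) w, of "{w, b}"] E by auto
  let ?C' = "(verts C - {w}, insert {a, b} R)"
  have cr: "cross (edges ?C') = cross (edges C)"
    using inW W by (simp add: E cross_insert_part)
  \<comment> \<open>The remaining cycle still contains \<open>a\<close>, so a part that includes it
    is \<open>W\<close> and contains \<open>w\<close> as well.\<close>
  have 1: "edges ?C' \<subseteq> edges G" using cyc(2) E part_edge[OF W(1) inW ab(1)] by auto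
  have 2: "verts C \<subseteq> V" if "V \<in> P" "verts ?C' \<subseteq> V" for V
  proof -
    have "a \<in> V" using that ab by auto
    then show ?thesis using part_eqI[OF that(1) W(1)] inW W that by auto
  qed
  have Y: "Y - verts C \<union> verts ?C' = Y - {w}" using cyc(3) C(2) by auto
  have 3: "verts ?C' \<subseteq> verts G" "verts ?C' \<inter> (Y - verts C) = {}"
    using cyc(3) cov_subset[OF cov] by auto
  have "cov (Y - {w}) (insert ?C' (\<C> - {C}))" "card (insert ?C' (\<C> - {C})) = card \<C>"
    using cov_replace[OF cov C(1) C' 1 3 between_card_le_cross_eq[OF cr] 2] unfolding Y by blast+
  then show ?thesis
    using that[of "insert ?C' (\<C> - {C})"] crossing_split[OF C(1)] cr
    by (simp add: crossing_insert subset_insertI)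
qed

lemma interior_triangle_subset:
  assumes cov: "cov Y \<C>" and C: "C \<in> \<C>" "w \<in> verts C" "\<not> 4 \<le> card (verts C)"
    and W: "W \<in> P" "w \<in> W" and w: "w \<notin> \<Union> (crossing \<C>)"
  obtains a b where "verts C = {w, a, b}" "a \<noteq> b" "a \<noteq> w" "b \<noteq> w" "verts C \<subseteq> W"
proof -
  note cyc = cov_cycle[OF cov C(1)]
  have "card (verts C) = 3" using C(3) cycle_finite(3)[OF cyc(1)] by linarith
  then obtain a b R where ab: "a \<noteq> b" "a \<noteq> w" "b \<noteq> w" "verts C = {w, a, b}"
    and E: "edges C = {{a, w}, {w, b}} \<union> R"
    using cycle_suppress_vertex[OF cyc(1) C(2)] by metis
  have "a \<in> W" "b \<in> W"
    using interior_edge_subset[OF cov C(1) W(2,1) w, of "{a, w}"]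
      interior_edge_subset[OF cov C(1) W(2,1) w, of "{w, b}"] E by auto
  then show ?thesis using W(2) by (intro that[OF ab(4,1-3)]) (simp add: ab(4))
qed

text \<open>A triangle through \<open>w\<close> cannot be shortened. A fourth interior vertex
  \<open>z\<close> is cut out of its own cycle and then takes the place of \<open>w\<close> in the
  triangle.\<close>

lemma cov_remove_interior:
  assumes cov: "cov Y \<C>" and W: "W \<in> P" and w: "w \<in> W" "w \<in> Y" "w \<notin> \<Union> (crossing \<C>)"
    and many: "4 \<le> card (W \<inter> Y - \<Union> (crossing \<C>))"
  obtains \<C>' where "cov (Y - {w}) \<C>'" "card \<C>' = card \<C>" "crossing \<C>' = crossing \<C>"
proof -
  obtain C where C: "C \<in> \<C>" "w \<in> verts C" using cov_obtain_cycle[OF cov w(2)] .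
  show ?thesis
  proof (cases "4 \<le> card (verts C)")
    case True
    then show ?thesis using cov_suppress_vertex[OF cov C _ W w(1,3)] that by metis
  next
    case False
    obtain a b where ab: "verts C = {w, a, b}" "a \<noteq> b" "a \<noteq> w" "b \<noteq> w" "verts C \<subseteq> W"
      using interior_triangle_subset[OF cov C False W w(1,3)] .
    have "\<not> W \<inter> Y - \<Union> (crossing \<C>) \<subseteq> verts C"
      using False many card_mono[of "verts C"] ab(1) by (metis finite.simps le_trans)
    then obtain z where z: "z \<in> W" "z \<in> Y" "z \<notin> \<Union> (crossing \<C>)" "z \<notin> verts C" by blast
    obtain D where D: "D \<in> \<C>" "z \<in> verts D" using cov_obtain_cycle[OF cov z(2)] .
    have "D \<noteq> C" using z D by blast
    \<comment> \<open>Otherwise \<open>D\<close> would be a second cycle inside \<open>W\<close>,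
      against canonicity.\<close>
    have "4 \<le> card (verts D)"
    proof (rule ccontr)
      assume "\<not> 4 \<le> card (verts D)"
      then have "verts D \<subseteq> W" using interior_triangle_subset[OF cov D _ W z(1,3)] by metis
      then show False using cov_inner_unique[OF cov W D(1) C(1) _ ab(5)] \<open>D \<noteq> C\<close> by blast
    qed
    then obtain \<D> where \<D>: "cov (Y - {z}) \<D>" "card \<D> = card \<C>" "crossing \<D> = crossing \<C>"
      "\<C> - {D} \<subseteq> \<D>"
      using cov_suppress_vertex[OF cov D _ W z(1,3)] by metis
    then have CD: "C \<in> \<D>" using C \<open>D \<noteq> C\<close> by blast
    let ?T = "({z, a, b}, {{z, a}, {a, b}, {b, z}})"
    have T: "is_cycle ?T" using is_cycle_listI[of z "[a, b]"] ab z(4) by auto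
    have inW: "a \<in> W" "b \<in> W" using ab by auto
    \<comment> \<open>Both triangles lie inside \<open>W\<close>, so neither has crossing
      edges.\<close>
    have cr: "cross (edges ?T) = cross (edges C)"
      using cycle_finite(4)[OF cov_cycle(1)[OF cov C(1)]] ab(5) inW z(1) W
      unfolding cross_def by fastforce
    have 1: "edges ?T \<subseteq> edges G"
      using part_edge[OF W z(1) inW(1)] part_edge[OF W inW] part_edge[OF W inW(2) z(1)] z ab by auto
    have 2: "verts C \<subseteq> V" if "V \<in> P" "verts ?T \<subseteq> V" for V
      using part_eqI[OF that(1) W _ z(1)] that(2) ab(5) by auto
    have 3: "verts ?T \<subseteq> verts G" "verts ?T \<inter> (Y - {z} - verts C) = {}"
      using inW z(1) part_subset[OF W] ab(1) by auto
    have Y: "Y - {z} - verts C \<union> verts ?T = Y - {w}"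
      using ab z w cov_cycle(3)[OF cov C(1)] by auto
    have "cov (Y - {w}) (insert ?T (\<D> - {C}))" "card (insert ?T (\<D> - {C})) = card \<D>"
      using cov_replace[OF \<D>(1) CD T 1 3 between_card_le_cross_eq[OF cr] 2] unfolding Y by blast+
    then show ?thesis
      using that[of "insert ?T (\<D> - {C})"] crossing_split[OF CD] cr \<D>(2,3)
      by (simp add: crossing_insert)
  qed
qed

text \<open>An interior \<open>z\<close> has a cycle edge inside \<open>W\<close>, and subdividing
  that edge by \<open>w\<close> needs only edges of the clique.\<close>

lemma cov_insert_vertex:
  assumes cov: "cov Y \<C>" and W: "W \<in> P" and w: "w \<in> W" "w \<notin> Y"
    and z: "z \<in> W" "z \<in> Y" "z \<notin> \<Union> (crossing \<C>)"
  obtains \<C>' where "cov (insert w Y) \<C>'" "card \<C>' = card \<C>"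
proof -
  obtain C where C: "C \<in> \<C>" "z \<in> verts C" using cov_obtain_cycle[OF cov z(2)] .
  note cyc = cov_cycle[OF cov C(1)]
  obtain a where a: "a \<noteq> z" "{a, z} \<in> edges C"
    using cycle_suppress_vertex[OF cyc(1) C(2)] by (metis UnCI insertCI)
  then have inW: "a \<in> W" using interior_edge_subset[OF cov C(1) z(1) W z(3)] by auto
  let ?C' = "(insert w (verts C), {{a, w}, {w, z}} \<union> (edges C - {{a, z}}))"
  have wC: "w \<notin> verts C" using w cyc(3) by blast
  have C': "is_cycle ?C'" using cycle_subdivide_edge[OF cyc(1) a(2) wC] .
  have cr: "cross (edges ?C') = cross (edges C)"
    using inW z(1) w(1) W unfolding cross_def by auto
  have 1: "edges ?C' \<subseteq> edges G"
    using cyc(2) part_edge[OF W inW w(1)] part_edge[OF W w(1) z(1)] inW wC cycle_finite(4)[OF cyc(1) a(2)] z(2) w(2)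
    by auto
  have 3: "verts ?C' \<subseteq> verts G" "verts ?C' \<inter> (Y - verts C) = {}"
    using cyc(3) cov_subset[OF cov] w part_subset[OF W] by auto
  have Y: "Y - verts C \<union> verts ?C' = insert w Y" using cyc(3) by auto
  have "cov (insert w Y) (insert ?C' (\<C> - {C}))" "card (insert ?C' (\<C> - {C})) = card \<C>"
    using cov_replace[OF cov C(1) C' 1 3 between_card_le_cross_eq[OF cr]] unfolding Y by auto
  then show ?thesis using that by blast
qed

text \<open>The accounting for a crossing edge traded for another one between the same two parts: no
  pair of parts gains crossing edges.\<close>

lemma cov_reroute:
  assumes cov: "cov Y \<C>" and C: "C \<in> \<C>" "{u, v} \<in> edges C"
    and AB: "A \<in> P" "B \<in> P" "A \<noteq> B" "u \<in> A" "u' \<in> A" "v \<in> B" "v' \<in> B"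
    and C': "is_cycle C'" "edges C' \<subseteq> edges G" "verts C \<subseteq> verts C'"
      "verts C' \<subseteq> verts C \<union> (verts G - Y)" "{u', v'} \<in> edges G"
      "cross (edges C') = insert {u', v'} (cross (edges C) - {{u, v}})"
  obtains \<C>' where "cov (Y \<union> verts C') \<C>'" "card \<C>' = card \<C>"
    "crossing \<C>' \<subseteq> insert {u', v'} (crossing \<C> - {{u, v}})"
proof -
  note cyc = cov_cycle[OF cov C(1)]
  have between: "card (edges C' \<inter> edges_between G W W') \<le> card (edges C \<inter> edges_between G W W')"
    if "W \<in> P" "W' \<in> P" "W \<noteq> W'" for W W'
  proof -
    let ?F = "edges_between G W W'"
    let ?K = "cross (edges C) \<inter> ?F"
    have fin: "finite ?K" using cycle_finite(2)[OF cyc(1)] unfolding cross_def by simp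
    have "\<not> {u, v} \<subseteq> V" if "V \<in> P" for V
      using part_eqI[OF that AB(1) _ AB(4)] part_eqI[OF that AB(2) _ AB(6)] AB(3) by auto
    then have uv: "{u, v} \<in> cross (edges C)" using C(2) unfolding cross_def by blast
    have same: "{u, v} \<in> ?F \<longleftrightarrow> {u', v'} \<in> ?F"
      using mem_edges_between_iff[OF AB(1-3) that(1,2)] AB C(2) cyc(2) C'(5) by (meson subsetD)
    \<comment> \<open>By \<open>same\<close>, the new edge counts for a pair of parts only where the
      old one is given up.\<close>
    have "card (cross (edges C') \<inter> ?F) \<le> card ?K"
    proof (cases "{u, v} \<in> ?F")
      case True
      then have "card (cross (edges C') \<inter> ?F) \<le> card (insert {u', v'} (?K - {{u, v}}))"
        using fin C'(6) by (intro card_mono) auto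
      also have "\<dots> \<le> Suc (card (?K - {{u, v}}))" by (rule card_insert_le_m1) auto
      also have "\<dots> = card ?K" using True uv fin by (intro card_Suc_Diff1) auto
      finally show ?thesis .
    next
      case False
      then show ?thesis using same fin C'(6) by (intro card_mono) auto
    qed
    then show ?thesis
      using edges_between_cross[OF that, of "edges C"] edges_between_cross[OF that, of "edges C'"]
      by simp
  qed
  have 3: "verts C' \<subseteq> verts G" "verts C' \<inter> (Y - verts C) = {}"
    using C'(4) cyc(3) cov_subset[OF cov] by auto
  have Y: "Y - verts C \<union> verts C' = Y \<union> verts C'" using C'(3) by auto
  let ?D = "insert C' (\<C> - {C})"
  have "cov (Y \<union> verts C') ?D" "card ?D = card \<C>"
    using cov_replace[OF cov C(1) C'(1,2) 3 between] C'(3) unfolding Y by auto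
  \<comment> \<open>No other cycle uses the old edge, since it would share \<open>u\<close> with
    \<open>C\<close>; so the edge leaves the whole family.\<close>
  moreover have "{u, v} \<notin> crossing (\<C> - {C})"
  proof
    assume "{u, v} \<in> crossing (\<C> - {C})"
    then obtain D where D: "D \<in> \<C>" "D \<noteq> C" "{u, v} \<in> edges D"
      using crossing_obtain_cycle[of "{u, v}" "\<C> - {C}"] by blast
    then have "u \<in> verts D" "u \<in> verts C"
      using cycle_finite(4)[OF cyc(1) C(2)] cycle_finite(4)[OF cov_cycle(1)[OF cov D(1)] D(3)]
      by auto
    then show False using cov C(1) D(1,2) unfolding cov_iff by blast
  qed
  ultimately show ?thesis
    using that[of ?D] crossing_split[OF C(1)] C'(6) by (auto simp: crossing_insert)
qed

text \<open>By canonicity the crossing edges towards one neighbouring part all belong to a single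
  cycle and number at most two. Each has one end in \<open>W\<close>, and the degree bounds the
  number of neighbouring parts.\<close>

lemma card_endpoints_le:
  assumes cov: "cov Y \<C>" and W: "W \<in> P"
  shows "card (\<Union> (crossing \<C>) \<inter> W) \<le> 2 * max_degree (contract G P)"
proof -
  let ?N = "nbrs (contract G P) W"
  let ?F = "\<lambda>W'. crossing \<C> \<inter> edges_between G W W'"
  have N: "W' \<in> P \<and> W' \<noteq> W" if "W' \<in> ?N" for W'
    using that unfolding nbrs_def contract_def by (auto simp: doubleton_eq_iff)
  then have finN: "finite ?N" using finite_parts by (meson finite_subset subsetI)
  have deg: "card ?N \<le> max_degree (contract G P)"
    unfolding max_degree_def using W finite_parts
    by (intro Max_ge) (auto simp: contract_def)
  have sub: "\<Union> (crossing \<C>) \<inter> W \<subseteq> (\<Union>W'\<in>?N. \<Union> (?F W') \<inter> W)"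
  proof
    fix x assume "x \<in> \<Union> (crossing \<C>) \<inter> W"
    then obtain e where e: "e \<in> crossing \<C>" "x \<in> e" "x \<in> W" by blast
    then have eG: "e \<in> cross (edges G)" using crossing_subset[OF cov] by blast
    then obtain A B u v where AB: "A \<in> P" "B \<in> P" "A \<noteq> B" "u \<in> A" "v \<in> B" "e = {u, v}"
      by (rule cross_edge_ends)
    obtain W' where W': "W' \<in> P" "W' \<noteq> W" "e \<in> edges_between G W W'"
    proof (cases "x = u")
      case True
      then have "A = W" using part_eqI AB(1,4) W e(3) by blast
      then show ?thesis
        using that[of B] AB eG unfolding edges_between_def cross_def by blast
    next
      case False
      then have "x = v" using e AB by simp
      then have "B = W" using part_eqI AB(2,5) W e(3) by blast
      then show ?thesis
        using that[of A] AB eG unfolding edges_between_def cross_def by blast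
    qed
    then have "W' \<in> ?N" using W unfolding nbrs_def contract_def by auto
    then show "x \<in> (\<Union>W'\<in>?N. \<Union> (?F W') \<inter> W)" using e W' by blast
  qed
  have two: "card (\<Union> (?F W') \<inter> W) \<le> 2" if "W' \<in> ?N" for W'
  proof -
    have W': "W' \<in> P" "W \<noteq> W'" using N[OF that] by auto
    have fin: "finite (?F W')" using finite_crossing[OF cov] by simp
    have "card (?F W') \<le> 2"
    proof (cases "?F W' = {}")
      case False
      then obtain C where C: "C \<in> \<C>" "edges C \<inter> edges_between G W W' \<noteq> {}"
        unfolding crossing_def cross_def by blast
      then have "?F W' \<subseteq> edges C \<inter> edges_between G W W'"
        using cov_between_unique[OF cov W W' C(1)] unfolding crossing_def cross_def by blast
      then show ?thesis
        using cov_between_card[OF cov W W' C(1)] cycle_finite(2)[OF cov_cycle(1)[OF cov C(1)]]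
          card_mono le_trans by (metis finite_Int)
    qed simp
    have "\<Union> (?F W') \<inter> W = (\<Union>e\<in>?F W'. e \<inter> W)" by blast
    then have "card (\<Union> (?F W') \<inter> W) \<le> (\<Sum>e\<in>?F W'. card (e \<inter> W))"
      using card_UN_le[OF fin, of "\<lambda>e. e \<inter> W"] by simp
    also have "\<dots> \<le> (\<Sum>e\<in>?F W'. 1)"
    proof (rule sum_mono)
      fix e assume "e \<in> ?F W'"
      then obtain u v where "u \<in> W" "v \<in> W'" "e = {u, v}" unfolding edges_between_def by blast
      then have "e \<inter> W = {u}" using part_eqI W W' by blast
      then show "card (e \<inter> W) \<le> 1" by simp
    qed
    finally show ?thesis using \<open>card (?F W') \<le> 2\<close> by simp
  qed
  have "card (\<Union> (crossing \<C>) \<inter> W) \<le> card (\<Union>W'\<in>?N. \<Union> (?F W') \<inter> W)"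
    using sub finN finite_part[OF W] by (intro card_mono) auto
  also have "\<dots> \<le> (\<Sum>W'\<in>?N. card (\<Union> (?F W') \<inter> W))" by (rule card_UN_le[OF finN])
  also have "\<dots> \<le> card ?N * 2"
    using sum_bounded_above[of ?N "\<lambda>W'. card (\<Union> (?F W') \<inter> W)" 2] two by simp
  finally show ?thesis using deg by linarith
qed

end

section \<open>The reduced parts\<close>

locale reduced_clique_partition = clique_partitioned +
  fixes \<Delta> :: nat and U :: "'a set \<Rightarrow> 'a set"
  assumes degree: "max_degree (contract G P) = \<Delta>" and reduction: "reduction G P \<Delta> U"
begin

section \<open>Sizes and links of the reduced parts\<close>

definition kept :: "'a set" where
  "kept = (\<Union>W\<in>P. U W)"

lemma mem_nbrs_contract_iff:
  "W' \<in> nbrs (contract G P) W \<longleftrightarrow>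
     W \<in> P \<and> W' \<in> P \<and> W \<noteq> W' \<and> edges_between G W W' \<noteq> {}"
proof -
  have sym: "edges_between G V V' = edges_between G V' V" for V V'
    unfolding edges_between_def by (auto simp: insert_commute)
  show ?thesis
  proof
    assume "W' \<in> nbrs (contract G P) W"
    then obtain V V' where V: "{W, W'} = {V, V'}" "V \<in> P" "V' \<in> P" "V \<noteq> V'"
      "edges_between G V V' \<noteq> {}"
      unfolding nbrs_def contract_def by auto
    from V(1) consider "W = V" "W' = V'" | "W = V'" "W' = V" by (auto simp: doubleton_eq_iff)
    then show "W \<in> P \<and> W' \<in> P \<and> W \<noteq> W' \<and> edges_between G W W' \<noteq> {}"
      using V sym by cases auto
  next
    assume "W \<in> P \<and> W' \<in> P \<and> W \<noteq> W' \<and> edges_between G W W' \<noteq> {}"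
    then show "W' \<in> nbrs (contract G P) W" unfolding nbrs_def contract_def by auto
  qed
qed

lemma nbrs_contract_sym: "W' \<in> nbrs (contract G P) W \<Longrightarrow> W \<in> nbrs (contract G P) W'"
  unfolding nbrs_def by (simp add: insert_commute)

definition choices ::
  "('a set \<Rightarrow> 'a set \<Rightarrow> 'a set set) \<Rightarrow> ('a set \<Rightarrow> 'a set \<Rightarrow> 'a set set) \<Rightarrow>
   ('a set \<Rightarrow> 'a set \<Rightarrow> 'a \<Rightarrow> 'a set) \<Rightarrow> bool" where
  "choices M M' S \<longleftrightarrow> (\<forall>W\<in>P. \<forall>W'\<in>nbrs (contract G P) W.
      M W W' = M W' W \<and> M' W W' = M' W' W \<and>
      maximal_matching (between_graph G W W') (M W W') \<and> M' W W' \<subseteq> M W W' \<and>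
      card (M' W W') = min (6 * \<Delta>) (card (M W W')) \<and>
      (\<forall>u\<in>matched M' W W'. S W W' u \<subseteq> nbrs G u \<inter> W' \<and>
         card (S W W' u) = min (card (nbrs G u \<inter> W')) (6 * \<Delta> - 1)))"

text \<open>The set \<open>U0\<close> of \<open>reduction\<close>, before arbitrary vertices are
  added.\<close>

definition links ::
  "('a set \<Rightarrow> 'a set \<Rightarrow> 'a set set) \<Rightarrow> ('a set \<Rightarrow> 'a set \<Rightarrow> 'a set set) \<Rightarrow>
   ('a set \<Rightarrow> 'a set \<Rightarrow> 'a \<Rightarrow> 'a set) \<Rightarrow> 'a set \<Rightarrow> 'a set" where
  "links M M' S W = (\<Union>W'\<in>nbrs (contract G P) W. link \<Delta> M M' S W W')"

lemma reduction_data: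
  obtains M M' S X where "choices M M' S"
    "\<forall>W\<in>P. X W \<subseteq> W - links M M' S W \<and>
      card (X W) = min (4 * \<Delta> + 3) (card (W - links M M' S W)) \<and> U W = links M M' S W \<union> X W"
proof -
  have "\<exists>M M' S X. choices M M' S \<and> (\<forall>W\<in>P. X W \<subseteq> W - links M M' S W \<and>
      card (X W) = min (4 * \<Delta> + 3) (card (W - links M M' S W)) \<and> U W = links M M' S W \<union> X W)"
    using reduction unfolding reduction_def Let_def choices_def links_def .
  then show ?thesis using that by metis
qed

lemma reduced_subset: "W \<in> P \<Longrightarrow> U W \<subseteq> W"
proof -
  assume W: "W \<in> P"
  obtain M M' S X where data: "choices M M' S"
    and X: "\<forall>W\<in>P. X W \<subseteq> W - links M M' S W \<and>
      card (X W) = min (4 * \<Delta> + 3) (card (W - links M M' S W)) \<and> U W = links M M' S W \<union> X W"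
    using reduction_data .
  have S: "S W W' u \<subseteq> nbrs G u \<inter> W'"
    if "W \<in> P" "W' \<in> nbrs (contract G P) W" "u \<in> matched M' W W'" for W W' u
    using data that unfolding choices_def by blast
  have "link \<Delta> M M' S W W' \<subseteq> W" if "W' \<in> nbrs (contract G P) W" for W'
  proof -
    \<comment> \<open>Vertices added on the side of \<open>W\<close> were chosen for the reversed
      pair, whence the symmetry of the neighbour relation.\<close>
    have "S W' W v \<subseteq> W" if "v \<in> matched M' W' W" for v
      using S[OF _ nbrs_contract_sym that] \<open>W' \<in> nbrs (contract G P) W\<close>
      by (auto simp: mem_nbrs_contract_iff)
    then show ?thesis unfolding link_def matched_def by auto
  qed
  then show ?thesis using bspec[OF X W] unfolding links_def by auto
qed

text \<open>If a vertex of \<open>W\<close> is left out, the arbitrary vertices did not exhaust the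
  rest of \<open>W\<close>, so the minimum in their number is
  \<open>4 * \<Delta> + 3\<close>.\<close>

lemma reduced_card:
  assumes W: "W \<in> P" and "\<not> W \<subseteq> U W"
  shows "4 * \<Delta> + 3 \<le> card (U W)"
proof -
  obtain M M' S X' where X': "choices M M' S" "\<forall>W\<in>P. X' W \<subseteq> W - links M M' S W \<and>
      card (X' W) = min (4 * \<Delta> + 3) (card (W - links M M' S W)) \<and> U W = links M M' S W \<union> X' W"
    using reduction_data .
  define X U0 where "X = X' W" and "U0 = links M M' S W"
  then have X: "X \<subseteq> W - U0" "card X = min (4 * \<Delta> + 3) (card (W - U0))" "U W = U0 \<union> X"
    using bspec[OF X'(2) W] by simp_all
  have "X \<noteq> W - U0" using X assms(2) by blast
  moreover have "finite (W - U0)" using finite_part[OF W] by simp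
  ultimately have "card X \<noteq> card (W - U0)" using X(1) card_subset_eq by blast
  then have "card X = 4 * \<Delta> + 3" using X(2) by linarith
  moreover have "card X \<le> card (U W)"
    using X(3) reduced_subset[OF W] finite_part[OF W] by (intro card_mono) (auto intro: finite_subset)
  ultimately show ?thesis by simp
qed

lemma reduced_nonempty: "W \<in> P \<Longrightarrow> U W \<noteq> {}"
  using reduced_card part_nonempty by (metis card.empty add_is_0 le_zero_eq subset_empty zero_neq_numeral)

lemma kept_Int_part: "W \<in> P \<Longrightarrow> kept \<inter> W = U W"
  using reduced_subset part_eqI unfolding kept_def by blast

text \<open>Maximality of the matching forces one end of \<open>{u, v}\<close> to be matched, and an end that was
  not kept leaves the other one with \<open>6 * \<Delta> - 1\<close> kept neighbours.\<close>

lemma reduction_cases: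
  assumes AB: "A \<in> P" "B \<in> P" "A \<noteq> B" and uv: "u \<in> A" "v \<in> B" "{u, v} \<in> edges G"
    and bad: "\<not> {u, v} \<subseteq> kept"
  obtains (matching) M where "disjoint M" "card M = 6 * \<Delta>"
      "\<And>e. e \<in> M \<Longrightarrow> \<exists>u'\<in>U A. \<exists>v'\<in>U B. e = {u', v'} \<and> e \<in> edges G"
  | (left) N where "N \<subseteq> nbrs G u \<inter> U B" "card N = 6 * \<Delta> - 1" "u \<in> U A" "v \<notin> U B"
  | (right) N where "N \<subseteq> nbrs G v \<inter> U A" "card N = 6 * \<Delta> - 1" "v \<in> U B" "u \<notin> U A"
proof -
  obtain M M' S X where M: "choices M M' S"
    and X: "\<forall>W\<in>P. X W \<subseteq> W - links M M' S W \<and>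
      card (X W) = min (4 * \<Delta> + 3) (card (W - links M M' S W)) \<and> U W = links M M' S W \<union> X W"
    using reduction_data .
  have nb: "B \<in> nbrs (contract G P) A" "A \<in> nbrs (contract G P) B"
    using AB uv unfolding mem_nbrs_contract_iff edges_between_def by (auto simp: insert_commute)
  have max: "maximal_matching (between_graph G A B) (M A B)" and sub: "M' A B \<subseteq> M A B"
    and cM': "card (M' A B) = min (6 * \<Delta>) (card (M A B))"
    and sym: "M A B = M B A" "M' A B = M' B A"
    using M AB(1) nb(1) unfolding choices_def by blast+
  have mat: "disjoint (M A B)" "M A B \<subseteq> edges_between G A B"
    using max unfolding maximal_matching_def matching_def between_graph_def by auto
  have link: "link \<Delta> M M' S A B \<subseteq> U A" "link \<Delta> M M' S B A \<subseteq> U B"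
    using X AB nb unfolding links_def by auto
  have mU: "matched M' A B \<subseteq> U A" "matched M' B A \<subseteq> U B"
    using link unfolding link_def by (auto split: if_splits)
  show ?thesis
  proof (cases "6 * \<Delta> \<le> card (M A B)")
    case True
    have "\<exists>u'\<in>U A. \<exists>v'\<in>U B. e = {u', v'} \<and> e \<in> edges G" if e: "e \<in> M' A B" for e
    proof -
      obtain u' v' where e': "u' \<in> A" "v' \<in> B" "e = {u', v'}" "e \<in> edges G"
        using e sub mat(2) unfolding edges_between_def by blast
      then have "u' \<in> matched M' A B" "v' \<in> matched M' B A"
        using e sym(2) unfolding matched_def by auto
      then show ?thesis using mU e' by blast
    qed
    moreover have "disjoint (M' A B)" using mat(1) sub pairwise_subset by blast
    ultimately show ?thesis using True cM' by (intro matching[of "M' A B"]) auto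
  next
    case False
    then have "card (M' A B) = card (M A B)" using cM' by simp
    moreover have "finite (M A B)"
      using finite_edges by (intro finite_subset[OF mat(2)]) (simp add: edges_between_def)
    ultimately have MM': "M' A B = M A B" using sub card_subset_eq by blast
    \<comment> \<open>With both ends free, \<open>{u, v}\<close> would extend the maximal
      matching.\<close>
    have touch: "u \<in> \<Union> (M A B) \<or> v \<in> \<Union> (M A B)"
    proof (rule ccontr)
      assume free: "\<not> (u \<in> \<Union> (M A B) \<or> v \<in> \<Union> (M A B))"
      have "disjoint (insert {u, v} (M A B))"
        using free mat(1) by (auto simp: pairwise_insert disjnt_def)
      moreover have "{u, v} \<in> edges_between G A B" using uv unfolding edges_between_def by blast
      ultimately have "matching (between_graph G A B) (insert {u, v} (M A B))"
        using mat(2) unfolding matching_def between_graph_def by simp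
      then have "insert {u, v} (M A B) = M A B" using max unfolding maximal_matching_def by blast
      then show False using free by blast
    qed
    \<comment> \<open>The neighbour \<open>y\<close> was not chosen for \<open>x\<close>, so the
      chosen set is a proper subset of the neighbours and the minimum in its size is
      \<open>6 * \<Delta> - 1\<close>.\<close>
    have small: "card (S W W' x) = 6 * \<Delta> - 1 \<and> S W W' x \<subseteq> nbrs G x \<inter> U W'"
      if "W \<in> P" "W' \<in> nbrs (contract G P) W" "x \<in> matched M' W W'" "y \<in> nbrs G x \<inter> W'"
        "y \<notin> U W'" "\<not> 6 * \<Delta> \<le> card (M W' W)" for W W' x y
    proof -
      have W': "W' \<in> P" using that(2) by (simp add: mem_nbrs_contract_iff)
      have "S W W' x \<subseteq> link \<Delta> M M' S W' W" using that(3,6) unfolding link_def by auto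
      also have "\<dots> \<subseteq> U W'" using bspec[OF X W'] nbrs_contract_sym[OF that(2)] unfolding links_def by auto
      finally have sU: "S W W' x \<subseteq> U W'" .
      have s: "S W W' x \<subseteq> nbrs G x \<inter> W'"
        "card (S W W' x) = min (card (nbrs G x \<inter> W')) (6 * \<Delta> - 1)"
        using M that(1-3) unfolding choices_def by blast+
      have "S W W' x \<subset> nbrs G x \<inter> W'" using s(1) sU that(4,5) by blast
      then have "card (S W W' x) < card (nbrs G x \<inter> W')"
        using finite_part[OF W'] by (intro psubset_card_mono) auto
      then show ?thesis using s sU by auto
    qed
    have kept: "x \<in> kept" if "W \<in> P" "x \<in> U W" for x W using that unfolding kept_def by blast
    show ?thesis
      using touch
    proof
      assume "u \<in> \<Union> (M A B)"
      then have um: "u \<in> matched M' A B" using uv(1) MM' unfolding matched_def by blast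
      then have "v \<notin> U B" using bad kept[OF AB(1)] kept[OF AB(2)] mU by auto
      moreover have "v \<in> nbrs G u \<inter> B" using uv unfolding nbrs_def by simp
      ultimately show ?thesis using small[OF AB(1) nb(1) um] False sym(1) left um mU(1) by (metis subsetD)
    next
      assume "v \<in> \<Union> (M A B)"
      then have vm: "v \<in> matched M' B A" using uv(2) MM' sym(2) unfolding matched_def by blast
      then have "u \<notin> U A" using bad kept[OF AB(1)] kept[OF AB(2)] mU by auto
      moreover have "u \<in> nbrs G v \<inter> A" using uv unfolding nbrs_def by (simp add: insert_commute)
      ultimately show ?thesis using small[OF AB(2) nb(2) vm] False sym(1) right vm mU(2) by (metis subsetD)
    qed
  qed
qed

section \<open>Moving crossing edges into the kept vertices\<close>

lemma card_endpoints_le': "cov Y \<C> \<Longrightarrow> W \<in> P \<Longrightarrow> card (\<Union> (crossing \<C>) \<inter> W) \<le> 2 * \<Delta>"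
  using card_endpoints_le unfolding degree .

text \<open>A fresh \<open>v'\<close> is moved into the edge \<open>{u, v}\<close>, so that \<open>{u, v'}\<close> crosses instead.\<close>

lemma shift_one_end:
  assumes cov: "cov (verts G) \<C>" and AB: "A \<in> P" "B \<in> P" "A \<noteq> B" "u \<in> A" "v \<in> B"
    and uv: "{u, v} \<in> crossing \<C>" and N: "N \<subseteq> nbrs G u \<inter> U B" "card N = 6 * \<Delta> - 1" "v \<notin> N"
  obtains \<C>' v' where "cov (verts G) \<C>'" "card \<C>' = card \<C>" "v' \<in> U B"
    "crossing \<C>' \<subseteq> insert {u, v'} (crossing \<C> - {{u, v}})"
proof -
  let ?X = "\<Union> (crossing \<C>)"
  have NB: "N \<subseteq> B" using N(1) reduced_subset[OF AB(2)] by blast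
  have fin: "finite (?X \<inter> B)" "finite N"
    using finite_part[OF AB(2)] NB by (auto intro: finite_subset)
  have v: "v \<in> ?X \<inter> B" using uv AB by blast
  \<comment> \<open>As \<open>v\<close> is an end of a crossing edge outside \<open>N\<close>, at
    most \<open>2 * \<Delta> - 1\<close> such ends lie in \<open>N\<close>. This leaves
    \<open>4 * \<Delta>\<close> interior vertices, enough for \<open>cov_remove_interior\<close>
    because \<Delta> is positive.\<close>
  have "card (?X \<inter> B - {v}) = card (?X \<inter> B) - 1" using v by (rule card_Diff_singleton)
  then have c: "card (?X \<inter> B - {v}) \<le> 2 * \<Delta> - 1" "0 < \<Delta>"
    using card_endpoints_le'[OF cov AB(2)] card_gt_0_iff[of "?X \<inter> B"] v fin by auto
  have "card N - card (?X \<inter> B - {v}) \<le> card (N - (?X \<inter> B - {v}))"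
    using fin by (intro diff_card_le_card_Diff) simp
  also have "N - (?X \<inter> B - {v}) = N - ?X" using N(3) NB by blast
  finally have cN: "4 \<le> card (N - ?X)" using c N(2) by linarith
  then obtain v' where v': "v' \<in> N" "v' \<notin> ?X" by (metis DiffE card.empty equals0I not_numeral_le_zero)
  have v'B: "v' \<in> B" "v' \<in> verts G" "v' \<in> U B" "{u, v'} \<in> edges G"
    using v'(1) NB part_subset[OF AB(2)] N(1) unfolding nbrs_def by auto
  have "card (N - ?X) \<le> card (B \<inter> verts G - ?X)"
    using finite_part[OF AB(2)] NB part_subset[OF AB(2)] by (intro card_mono) auto
  then have many: "4 \<le> card (B \<inter> verts G - ?X)" using cN by linarith
  obtain \<D> where \<D>: "cov (verts G - {v'}) \<D>" "card \<D> = card \<C>" "crossing \<D> = crossing \<C>"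
    using cov_remove_interior[OF cov AB(2) v'B(1,2) v'(2) many] .
  obtain C where C: "C \<in> \<D>" "{u, v} \<in> edges C"
    using crossing_obtain_cycle[of "{u, v}" \<D>] uv \<D>(3) by auto
  note cyc = cov_cycle[OF \<D>(1) C(1)]
  have v'C: "v' \<notin> verts C" using cyc(3) by blast
  let ?C' = "(insert v' (verts C), {{u, v'}, {v', v}} \<union> (edges C - {{u, v}}))"
  have C': "is_cycle ?C'" using cycle_subdivide_edge[OF cyc(1) C(2) v'C] .
  have 1: "edges ?C' \<subseteq> edges G"
    using cyc(2) v'B(4) part_edge[OF AB(2) v'B(1) AB(5)] N(3) v'(1) by auto
  have "\<not> {u, v'} \<subseteq> W" if "W \<in> P" for W
    using part_eqI[OF that AB(1) _ AB(4)] part_eqI[OF that AB(2) _ v'B(1)] AB(3) by auto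
  then have cr: "cross (edges ?C') = insert {u, v'} (cross (edges C) - {{u, v}})"
    using AB(2,5) v'B(1) unfolding cross_def by auto
  obtain \<C>' where \<C>': "cov (verts G - {v'} \<union> verts ?C') \<C>'" "card \<C>' = card \<D>"
    "crossing \<C>' \<subseteq> insert {u, v'} (crossing \<D> - {{u, v}})"
    using cov_reroute[OF \<D>(1) C AB(1-4) AB(4,5) v'B(1) C' 1 _ _ v'B(4) cr] v'B(2) by auto
  have "verts G - {v'} \<union> verts ?C' = verts G" using cyc(3) v'B(2) by auto
  then show ?thesis using \<C>' \<D> v'B(3) that by simp
qed

text \<open>Both ends of a fresh matching edge \<open>{u', v'}\<close> are moved into \<open>{u, v}\<close>: the cycle now runs
  through \<open>u\<close>, \<open>u'\<close>, \<open>v'\<close>, \<open>v\<close>.\<close>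

lemma shift_both_ends:
  assumes cov: "cov (verts G) \<C>" and AB: "A \<in> P" "B \<in> P" "A \<noteq> B" "u \<in> A" "v \<in> B"
    and uv: "{u, v} \<in> crossing \<C>" and M: "disjoint M" "card M = 6 * \<Delta>"
      "\<And>e. e \<in> M \<Longrightarrow> \<exists>u'\<in>U A. \<exists>v'\<in>U B. e = {u', v'} \<and> e \<in> edges G"
  obtains \<C>' u' v' where "cov (verts G) \<C>'" "card \<C>' = card \<C>" "u' \<in> U A" "v' \<in> U B"
    "crossing \<C>' \<subseteq> insert {u', v'} (crossing \<C> - {{u, v}})"
proof -
  let ?X = "\<Union> (crossing \<C>)"
  have UAB: "U A \<subseteq> A" "U B \<subseteq> B" using reduced_subset AB by auto
  have fin: "finite A" "finite B" using finite_part AB by auto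
  have bound: "card (?X \<inter> A) \<le> 2 * \<Delta>" "card (?X \<inter> B) \<le> 2 * \<Delta>"
    using card_endpoints_le'[OF cov] AB by auto
  have "0 < card (?X \<inter> A)" using uv AB fin by (auto simp: card_gt_0_iff)
  then have pos: "0 < \<Delta>" using bound by linarith
  \<comment> \<open>The matching edges are disjoint, so the at most \<open>4 * \<Delta>\<close> ends
    of crossing edges in the two parts spoil at most that many of the
    \<open>6 * \<Delta>\<close>.\<close>
  have "card {e \<in> M. e \<inter> (?X \<inter> (A \<union> B)) \<noteq> {}} \<le> card (?X \<inter> (A \<union> B))"
    using M(1) fin by (intro card_le_by_disjoint_traces) (auto intro: pairwise_subset)
  also have "\<dots> \<le> 4 * \<Delta>"
    using bound card_Un_le[of "?X \<inter> A" "?X \<inter> B"] by (simp add: Int_Un_distrib)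
  also have "\<dots> < card M" using pos M(2) by simp
  finally have "{e \<in> M. e \<inter> (?X \<inter> (A \<union> B)) \<noteq> {}} \<noteq> M" by (metis less_irrefl)
  then obtain e where e: "e \<in> M" "e \<inter> (?X \<inter> (A \<union> B)) = {}" by blast
  then obtain u' v' where e': "u' \<in> U A" "v' \<in> U B" "{u', v'} \<in> edges G" "e = {u', v'}"
    using M(3) by metis
  then have in': "u' \<in> A" "v' \<in> B" "u' \<in> verts G" "v' \<in> verts G"
    using UAB part_subset AB(1,2) by auto
  then have X: "u' \<notin> ?X" "v' \<notin> ?X" using e(2) e'(4) by auto
  have uvX: "u \<in> ?X" "v \<in> ?X" using uv by auto
  have "u' \<notin> B" using part_eqI[OF AB(1,2) in'(1)] AB(3) by blast
  then have ne: "u' \<noteq> u" "v' \<noteq> v" "u' \<noteq> v'" "u' \<noteq> v" "u' \<notin> B" "v' \<noteq> u"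
    using X uvX in'(2) by metis+
  \<comment> \<open>Each matching edge has its own end in \<open>W\<close>, so at least
    \<open>6 * \<Delta> - 2 * \<Delta>\<close> vertices of \<open>W\<close> are interior.\<close>
  have "4 \<le> card (W - ?X)" if W: "W = A \<or> W = B" for W
  proof -
    have f: "finite W" "card (?X \<inter> W) \<le> 2 * \<Delta>" using W fin bound by auto
    have "card M \<le> card W"
      using M(1,3) W UAB f(1) by (intro card_le_by_disjoint_traces) fastforce+
    moreover have "W - ?X = W - (?X \<inter> W)" by blast
    ultimately show ?thesis
      using f M(2) pos diff_card_le_card_Diff[of "?X \<inter> W" W] by simp
  qed
  moreover have "A \<inter> verts G = A" "B \<inter> (verts G - {u'}) = B"
    using part_subset AB(1,2) ne(5) by auto
  ultimately have many: "4 \<le> card (A \<inter> verts G - ?X)" "4 \<le> card (B \<inter> (verts G - {u'}) - ?X)"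
    by simp_all
  obtain \<D> where \<D>: "cov (verts G - {u'}) \<D>" "card \<D> = card \<C>" "crossing \<D> = crossing \<C>"
    using cov_remove_interior[OF cov AB(1) in'(1,3) X(1) many(1)] .
  obtain \<E> where \<E>: "cov (verts G - {u'} - {v'}) \<E>" "card \<E> = card \<D>" "crossing \<E> = crossing \<D>"
    using cov_remove_interior[OF \<D>(1) AB(2) in'(2), unfolded \<D>(3), OF _ X(2) many(2)]
      in'(4) ne(3) \<D>(3) by auto
  obtain C where C: "C \<in> \<E>" "{u, v} \<in> edges C"
    using crossing_obtain_cycle[of "{u, v}" \<E>] uv \<D>(3) \<E>(3) by auto
  note cyc = cov_cycle[OF \<E>(1) C(1)]
  have nC: "u' \<notin> verts C" "v' \<notin> verts C" using cyc(3) by auto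
  \<comment> \<open>The auxiliary edge \<open>{u', v}\<close> may be missing from \<open>G\<close>.
    It disappears with the second subdivision, and only the final cycle has to lie in
    \<open>G\<close>.\<close>
  let ?C1 = "(insert u' (verts C), {{u, u'}, {u', v}} \<union> (edges C - {{u, v}}))"
  have C1: "is_cycle ?C1" using cycle_subdivide_edge[OF cyc(1) C(2) nC(1)] .
  let ?C' = "(insert v' (verts ?C1), {{u', v'}, {v', v}} \<union> (edges ?C1 - {{u', v}}))"
  have C': "is_cycle ?C'" using nC ne by (intro cycle_subdivide_edge[OF C1]) auto
  have "{u', v} \<notin> edges C" using cycle_finite(4)[OF cyc(1)] nC by blast
  moreover have "{u, u'} \<noteq> {u', v}" using ne AB part_eqI by (metis doubleton_eq_iff)
  ultimately have "edges ?C1 - {{u', v}} = {{u, u'}} \<union> (edges C - {{u, v}})" by auto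
  then have E: "edges ?C' = {{u', v'}, {v', v}, {u, u'}} \<union> (edges C - {{u, v}})" by auto
  have 1: "edges ?C' \<subseteq> edges G"
    unfolding E using cyc(2) e'(3) part_edge[OF AB(2) in'(2) AB(5)] part_edge[OF AB(1,4) in'(1)] ne
    by auto
  have "\<not> {u', v'} \<subseteq> W" if "W \<in> P" for W
    using part_eqI[OF that AB(1) _ in'(1)] part_eqI[OF that AB(2) _ in'(2)] AB(3) by auto
  then have cr: "cross (edges ?C') = insert {u', v'} (cross (edges C) - {{u, v}})"
    unfolding E using AB in' unfolding cross_def by auto
  obtain \<C>' where \<C>': "cov (verts G - {u'} - {v'} \<union> verts ?C') \<C>'" "card \<C>' = card \<E>"
    "crossing \<C>' \<subseteq> insert {u', v'} (crossing \<E> - {{u, v}})"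
    using cov_reroute[OF \<E>(1) C AB(1-4) in'(1) AB(5) in'(2) C' 1 _ _ e'(3) cr] in' by auto
  have "verts G - {u'} - {v'} \<union> verts ?C' = verts G" using cyc(3) in' by auto
  then show ?thesis using \<C>' \<D> \<E> e' that by simp
qed

text \<open>The cases of \<open>reduction_cases\<close> supply the fresh kept ends;
  \<open>right\<close> is \<open>left\<close> with the two parts exchanged.\<close>

lemma replace_bad_crossing:
  assumes cov: "cov (verts G) \<C>" and e: "e \<in> crossing \<C>" "\<not> e \<subseteq> kept"
  obtains \<C>' e' where "cov (verts G) \<C>'" "card \<C>' = card \<C>" "e' \<subseteq> kept"
    "crossing \<C>' \<subseteq> insert e' (crossing \<C> - {e})"
proof -
  have eG: "e \<in> cross (edges G)" using crossing_subset[OF cov] e(1) by blast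
  obtain A B u v where AB: "A \<in> P" "B \<in> P" "A \<noteq> B" "u \<in> A" "v \<in> B" "e = {u, v}"
    using cross_edge_ends[OF eG] .
  have kept: "x \<in> kept" if "W \<in> P" "x \<in> U W" for x W using that unfolding kept_def by blast
  have "{u, v} \<in> edges G" using eG AB(6) unfolding cross_def by simp
  from AB(1-5) this e(2)[unfolded AB(6)] show ?thesis
  proof (cases rule: reduction_cases)
    case (matching M)
    then show ?thesis
      using shift_both_ends[OF cov AB(1-5) e(1)[unfolded AB(6)]] kept AB that
      by (metis empty_subsetI insert_subset)
  next
    case (left N)
    then have "v \<notin> N" by blast
    then show ?thesis
      using shift_one_end[OF cov AB(1-5) e(1)[unfolded AB(6)] left(1,2)] kept AB that left(3)
      by (metis empty_subsetI insert_subset)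
  next
    case (right N)
    then have "u \<notin> N" by blast
    moreover have vu: "e = {v, u}" using AB(6) by (simp add: insert_commute)
    ultimately show ?thesis
      using shift_one_end[OF cov AB(2,1) AB(3)[symmetric] AB(5,4) e(1)[unfolded vu] right(1,2)]
        kept AB(1,2) that right(3)
      by (metis empty_subsetI insert_subset)
  qed
qed

text \<open>Induction on the number of crossing edges that are not kept: each replacement removes
  one and adds none.\<close>

lemma all_crossings_kept:
  assumes "cov (verts G) \<C>"
  obtains \<C>' where "cov (verts G) \<C>'" "card \<C>' = card \<C>" "\<Union> (crossing \<C>') \<subseteq> kept"
  using assms
proof (induction "card {e \<in> crossing \<C>. \<not> e \<subseteq> kept}" arbitrary: \<C> thesis rule: less_induct)
  case less
  show ?case
  proof (cases "\<Union> (crossing \<C>) \<subseteq> kept")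
    case True
    then show ?thesis using less.prems by blast
  next
    case False
    then obtain e where e: "e \<in> crossing \<C>" "\<not> e \<subseteq> kept" by blast
    obtain \<D> e' where \<D>: "cov (verts G) \<D>" "card \<D> = card \<C>" "e' \<subseteq> kept"
      "crossing \<D> \<subseteq> insert e' (crossing \<C> - {e})"
      using replace_bad_crossing[OF less.prems(2) e] .
    have "card {e \<in> crossing \<D>. \<not> e \<subseteq> kept} < card {e \<in> crossing \<C>. \<not> e \<subseteq> kept}"
      using \<D>(3,4) e finite_crossing[OF less.prems(2)] by (intro psubset_card_mono) auto
    from less.hyps[OF this _ \<D>(1)] show ?thesis using less.prems(1) \<D>(2) by metis
  qed
qed

section \<open>Restricting covers to the kept vertices and extending them back\<close>

lemma interior_kept_card:
  assumes "cov Y \<C>" "W \<in> P" "\<not> W \<subseteq> U W"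
  shows "3 \<le> card (U W - \<Union> (crossing \<C>))"
proof -
  have "finite W" "U W \<subseteq> W" using assms(2) finite_part reduced_subset by auto
  then have "card (U W) - card (\<Union> (crossing \<C>) \<inter> W) \<le> card (U W - (\<Union> (crossing \<C>) \<inter> W))"
    by (intro diff_card_le_card_Diff) simp
  moreover have "U W - (\<Union> (crossing \<C>) \<inter> W) = U W - \<Union> (crossing \<C>)"
    using \<open>U W \<subseteq> W\<close> by blast
  \<comment> \<open>The count is \<open>(4 * \<Delta> + 3) - 2 * \<Delta>\<close>, which is at least
    3.\<close>
  ultimately show ?thesis
    using reduced_card[OF assms(2,3)] card_endpoints_le'[OF assms(1,2)] by simp
qed

lemma kept_subset: "kept \<subseteq> verts G"
  using reduced_subset part_subset unfolding kept_def by blast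

lemma shrink_to_kept:
  assumes "cov Y \<C>" "kept \<subseteq> Y" "\<Union> (crossing \<C>) \<subseteq> kept"
  obtains \<C>' where "cov kept \<C>'" "card \<C>' = card \<C>"
  using assms
proof (induction "card (Y - kept)" arbitrary: Y \<C> thesis rule: less_induct)
  case less
  show ?case
  proof (cases "Y = kept")
    case True
    then show ?thesis using less.prems by blast
  next
    case False
    then obtain w where w: "w \<in> Y" "w \<notin> kept" using less.prems(3) by blast
    then obtain W where W: "W \<in> P" "w \<in> W" using cov_subset[OF less.prems(2)] part_exists by blast
    have wU: "w \<notin> U W" using w(2) W(1) unfolding kept_def by blast
    have fin: "finite W" "U W \<subseteq> W" using W(1) finite_part reduced_subset by auto
    have "3 \<le> card (U W - \<Union> (crossing \<C>))"
      using interior_kept_card[OF less.prems(2) W(1)] wU W(2) by blast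
    \<comment> \<open>The vertex \<open>w\<close> itself is the fourth interior vertex that
      \<open>cov_remove_interior\<close> asks for.\<close>
    also have "\<dots> < card (insert w (U W - \<Union> (crossing \<C>)))"
      using wU fin finite_subset[OF fin(2)] by simp
    also have "\<dots> \<le> card (W \<inter> Y - \<Union> (crossing \<C>))"
      using fin W w less.prems(3,4) by (intro card_mono) (auto simp: kept_def)
    finally have many: "4 \<le> card (W \<inter> Y - \<Union> (crossing \<C>))" by simp
    have wX: "w \<notin> \<Union> (crossing \<C>)" using w(2) less.prems(4) by blast
    obtain \<D> where \<D>: "cov (Y - {w}) \<D>" "card \<D> = card \<C>" "crossing \<D> = crossing \<C>"
      using cov_remove_interior[OF less.prems(2) W(1,2) w(1) wX many] .
    have "finite Y" using cov_subset[OF less.prems(2)] finite_verts by (rule finite_subset)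
    then have "card (Y - {w} - kept) < card (Y - kept)"
      using w by (intro psubset_card_mono) auto
    from less.hyps[OF this _ \<D>(1)] show ?thesis
      using less.prems \<D>(2,3) w(2) by (metis Diff_empty subset_Diff_insert)
  qed
qed

text \<open>The crossing edges need not be tracked: \<open>interior_kept_card\<close> holds for
  every cover, so an interior kept vertex is available at each insertion.\<close>

lemma grow_from_kept:
  assumes "cov Y \<C>" "kept \<subseteq> Y"
  obtains \<C>' where "cov (verts G) \<C>'" "card \<C>' = card \<C>"
  using assms
proof (induction "card (verts G - Y)" arbitrary: Y \<C> thesis rule: less_induct)
  case less
  show ?case
  proof (cases "Y = verts G")
    case True
    then show ?thesis using less.prems by blast
  next
    case False
    then obtain w where w: "w \<in> verts G" "w \<notin> Y" using cov_subset[OF less.prems(2)] by blast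
    then obtain W where W: "W \<in> P" "w \<in> W" using part_exists by blast
    have UY: "U W \<subseteq> Y" using less.prems(3) W(1) unfolding kept_def by blast
    then have "3 \<le> card (U W - \<Union> (crossing \<C>))"
      using interior_kept_card[OF less.prems(2) W(1)] w(2) W(2) by blast
    then have "U W - \<Union> (crossing \<C>) \<noteq> {}" by (metis card.empty not_numeral_le_zero)
    then obtain z where z: "z \<in> U W" "z \<notin> \<Union> (crossing \<C>)" by blast
    then obtain \<D> where \<D>: "cov (insert w Y) \<D>" "card \<D> = card \<C>"
      using cov_insert_vertex[OF less.prems(2) W w(2)] UY reduced_subset[OF W(1)]
      by (metis subsetD)
    have "card (verts G - insert w Y) < card (verts G - Y)"
      using w finite_verts by (intro psubset_card_mono) auto
    from less.hyps[OF this _ \<D>(1)] show ?thesis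
      using less.prems \<D>(2) by (metis subset_insertI2)
  qed
qed

section \<open>Passing to the reduced graph and its parts\<close>

lemma induced_verts: "induced G (verts G) = G"
  using edge_subset unfolding induced_def by (auto intro: prod_eqI)

text \<open>The reduced parts are nonempty subsets of disjoint parts. Injectivity lets pairs of
  distinct parts correspond on both sides of the canonicity condition.\<close>

lemma inj_on_reduced: "inj_on U P"
proof (rule inj_onI)
  fix W W' assume W: "W \<in> P" "W' \<in> P" "U W = U W'"
  then obtain x where "x \<in> U W" using reduced_nonempty by blast
  then have "x \<in> W" "x \<in> W'" using W reduced_subset by auto
  then show "W = W'" using W(1,2) part_eqI by metis
qed

text \<open>Cycles of the cover stay inside \<open>kept\<close>, which meets each part
  \<open>W\<close> exactly in \<open>U W\<close>. So containment in a part and edges between parts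
  mean the same on both sides.\<close>

lemma canonical_kept_iff:
  assumes "cycle_cover (induced G kept) \<C>"
  shows "canonical (induced G kept) (U ` P) \<C> \<longleftrightarrow> canonical G P \<C>"
proof -
  have sub: "verts C \<subseteq> kept" "edges C \<subseteq> edges (induced G kept)" if "C \<in> \<C>" for C
    using assms that unfolding cycle_cover_def disjoint_cycles_def subgraph_def induced_def by auto
  have inner: "C \<in> \<C> \<and> verts C \<subseteq> U W \<longleftrightarrow> C \<in> \<C> \<and> verts C \<subseteq> W" if "W \<in> P" for C W
    using sub(1)[of C] kept_Int_part[OF that] by blast
  have between: "edges C \<inter> edges_between (induced G kept) (U W) (U W') =
      edges C \<inter> edges_between G W W'" if "W \<in> P" "W' \<in> P" "C \<in> \<C>" for C W W'
  proof -
    have "e \<in> edges_between (induced G kept) (U W) (U W') \<longleftrightarrow> e \<in> edges_between G W W'"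
      if "e \<in> edges (induced G kept)" for e
      using that
      unfolding edges_between_def induced_def kept_Int_part[OF \<open>W \<in> P\<close>, symmetric]
        kept_Int_part[OF \<open>W' \<in> P\<close>, symmetric]
      by fastforce
    then show ?thesis using sub(2)[OF that(3)] by blast
  qed
  have cut: "C \<in> \<C> \<and> edges C \<inter> edges_between (induced G kept) (U W) (U W') \<noteq> {} \<longleftrightarrow>
      C \<in> \<C> \<and> edges C \<inter> edges_between G W W' \<noteq> {}" if "W \<in> P" "W' \<in> P" for C W W'
    using between[OF that, of C] by (cases "C \<in> \<C>") simp_all
  have ne: "U W \<noteq> U W' \<longleftrightarrow> W \<noteq> W'" if "W \<in> P" "W' \<in> P" for W W'
    using inj_on_reduced that by (auto dest: inj_onD)
  show ?thesis
    unfolding canonical_def ball_simps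
    by (simp add: inner cut ne between cong: ball_cong)
qed

lemma canonical_cover_iff:
  "has_canonical_cycle_cover G P k \<longleftrightarrow> has_canonical_cycle_cover (induced G kept) (U ` P) k"
proof -
  have "has_canonical_cycle_cover G P k \<longleftrightarrow> (\<exists>\<C>. cov (verts G) \<C> \<and> card \<C> = k)"
    unfolding has_canonical_cycle_cover_def cov_def induced_verts by simp
  also have "\<dots> \<longleftrightarrow> (\<exists>\<C>. cov kept \<C> \<and> card \<C> = k)"
  proof
    assume "\<exists>\<C>. cov (verts G) \<C> \<and> card \<C> = k"
    then obtain \<C> where "cov (verts G) \<C>" "card \<C> = k" by blast
    then obtain \<D> where \<D>: "cov (verts G) \<D>" "card \<D> = k" "\<Union> (crossing \<D>) \<subseteq> kept"
      using all_crossings_kept by metis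
    then show "\<exists>\<C>. cov kept \<C> \<and> card \<C> = k"
      using shrink_to_kept[OF \<D>(1) kept_subset \<D>(3)] by metis
  next
    assume "\<exists>\<C>. cov kept \<C> \<and> card \<C> = k"
    then show "\<exists>\<C>. cov (verts G) \<C> \<and> card \<C> = k" using grow_from_kept by (metis subset_refl)
  qed
  also have "\<dots> \<longleftrightarrow> has_canonical_cycle_cover (induced G kept) (U ` P) k"
    unfolding has_canonical_cycle_cover_def cov_def using canonical_kept_iff kept_subset by blast
  finally show ?thesis .
qed

end

theorem theorem5p7:
  fixes G :: "'a graph" and P :: "'a set set" and \<Delta> k :: nat
    and U :: "'a set \<Rightarrow> 'a set" and H :: "'a graph" and P' :: "'a set set"
  assumes "simple_graph G"
    and "clique_partition G P"
    and "max_degree (contract G P) = \<Delta>"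
    and "reduction G P \<Delta> U"
    and "H = induced G (\<Union>W\<in>P. U W)"
    and "P' = U ` P"
  shows "has_canonical_cycle_cover G P k \<longleftrightarrow> has_canonical_cycle_cover H P' k"
proof -
  interpret reduced_clique_partition G P \<Delta> U
    using assms(1-4) by unfold_locales
  show ?thesis using canonical_cover_iff unfolding assms(5,6) kept_def .
qed

end
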